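(* Consider instances $(\mathcal{X},d)$, $\mathcal{X}=\bigcup_{i=1}^m\mathcal{X}_i$, $k_1,\dots,k_m$ of Fair Max-Min diversification with $|\mathcal{X}|=n$, $k=\sum_i k_i$ and optimal diversity $\ell^*$, in which the ratio between the largest and the smallest distance between distinct points is $\mathrm{poly}(n)$. For every $\epsilon>0$ there is an algorithm that returns an $(m+1)(1+\epsilon)$-approximation with perfect fairness, i.e. a set $\mathcal{S}\subseteq\mathcal{X}$ with $$\mathrm{div}(\mathcal{S})\ge \frac{\ell^*}{(m+1)(1+\epsilon)}\quad\text{and}\quad |\mathcal{S}\cap\mathcal{X}_i|\ge k_i\ \ \forall i\in[m],$$ in running time $O(nkm^3\epsilon^{-1}\log n)$.
   Context: Fair Max-Min diversification: the input is a finite metric space $(\mathcal{X},d)$ with $|\mathcal{X}|=n$, where $\mathcal{X}=\bigcup_{i=1}^m\mathcal{X}_i$ is partitioned into $m$ disjoint groups, and non-negative integers $k_1,\dots,k_m$ with $k_i\le|\mathcal{X}_i|$. For $\mathcal{S}\subseteq\mathcal{X}$ let $\mathrm{div}(\mathcal{S})=\min_{u,v\in\mathcal{S},u\ne v}d(u,v)$ (the minimum over the empty set is $+\infty$). The optimal diversity is $\ell^*=\max\{\mathrm{div}(\mathcal{S}):\mathcal{S}\subseteq\mathcal{X},\ |\mathcal{S}\cap\mathcal{X}_i|=k_i\ \forall i\in[m]\}$. A distance evaluation costs $O(1)$ time. *)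

theory Defs
  imports "HOL-Analysis.Analysis"
begin

section \<open>Fair Max-Min diversification\<close>

text \<open>Groups are numbered \<open>0, \<dots>, m - 1\<close>; \<open>G i\<close> is the \<open>i\<close>-th group and \<open>ks i\<close> its required count.\<close>

locale fair_instance = Metric_space X d
  for X :: "'a set" and d :: "'a \<Rightarrow> 'a \<Rightarrow> real" +
  fixes m :: nat and G :: "nat \<Rightarrow> 'a set" and ks :: "nat \<Rightarrow> nat"
  assumes finite_points: "finite X"
    and groups_cover: "(\<Union>i<m. G i) = X"
    and groups_disjoint: "disjoint_family_on G {..<m}"
    and counts_feasible: "\<And>i. i < m \<Longrightarrow> ks i \<le> card (G i)"

text \<open>The infimum of the empty set in \<^typ>\<open>ereal\<close> is \<open>\<infinity>\<close>, so sets with at most one point have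
  diversity \<open>\<infinity>\<close>; for other finite sets the infimum is a minimum.\<close>

definition diversity :: "('a \<Rightarrow> 'a \<Rightarrow> real) \<Rightarrow> 'a set \<Rightarrow> ereal" where
  "diversity d S = Inf {ereal (d u v) | u v. u \<in> S \<and> v \<in> S \<and> u \<noteq> v}"

definition opt_diversity ::
    "'a set \<Rightarrow> ('a \<Rightarrow> 'a \<Rightarrow> real) \<Rightarrow> nat \<Rightarrow> (nat \<Rightarrow> 'a set) \<Rightarrow> (nat \<Rightarrow> nat) \<Rightarrow> ereal" where
  "opt_diversity X d m G ks =
     Max (diversity d ` {S. S \<subseteq> X \<and> (\<forall>i<m. card (S \<inter> G i) = ks i)})"

definition aspect_ratio :: "'a set \<Rightarrow> ('a \<Rightarrow> 'a \<Rightarrow> real) \<Rightarrow> real" where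
  "aspect_ratio X d =
     (let D = {d u v | u v. u \<in> X \<and> v \<in> X \<and> u \<noteq> v} in Max D / Min D)"


section \<open>Unit-cost random access machine with a distance oracle\<close>

text \<open>A program works on natural-number and real scalars and arrays. Every operator, variable access,
  array access, test, assignment and distance evaluation takes one unit of time. On natural numbers
  there is only addition and (truncated) subtraction, so that numbers of superpolynomial length
  cannot be built in polynomial time. The only literals are natural numbers, and
  there is no rounding of reals; reals influence the control flow only through comparisons.\<close>

datatype nexp =
    NLit nat
  | NVar string
  | NCell string nexp
  | NAdd nexp nexp
  | NSub nexp nexp

datatype rexp =
    OfNat nexp
  | RVar string
  | RCell string nexp
  | Dist nexp nexp
  | RAdd rexp rexp
  | RSub rexp rexp
  | RMul rexp rexp
  | RDiv rexp rexp

datatype bexp =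
    NLess nexp nexp
  | NEq nexp nexp
  | RLess rexp rexp
  | REq rexp rexp
  | BNot bexp
  | BAnd bexp bexp

datatype com =
    Skip
  | NAssign string nexp
  | NStore string nexp nexp
  | RAssign string rexp
  | RStore string nexp rexp
  | Seq com com
  | Cond bexp com com
  | Loop bexp com

record state =
  nvar :: "string \<Rightarrow> nat"
  narr :: "string \<Rightarrow> nat \<Rightarrow> nat"
  rvar :: "string \<Rightarrow> real"
  rarr :: "string \<Rightarrow> nat \<Rightarrow> real"

fun nval :: "nexp \<Rightarrow> state \<Rightarrow> nat" where
  "nval (NLit k) s = k"
| "nval (NVar x) s = nvar s x"
| "nval (NCell x i) s = narr s x (nval i s)"
| "nval (NAdd a b) s = nval a s + nval b s"
| "nval (NSub a b) s = nval a s - nval b s"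

fun ncost :: "nexp \<Rightarrow> nat" where
  "ncost (NLit k) = 1"
| "ncost (NVar x) = 1"
| "ncost (NCell x i) = 1 + ncost i"
| "ncost (NAdd a b) = 1 + ncost a + ncost b"
| "ncost (NSub a b) = 1 + ncost a + ncost b"

text \<open>\<open>\<delta> i j\<close> is the distance between the points with indices \<open>i\<close> and \<open>j\<close>.\<close>

fun rval :: "(nat \<Rightarrow> nat \<Rightarrow> real) \<Rightarrow> rexp \<Rightarrow> state \<Rightarrow> real" where
  "rval \<delta> (OfNat a) s = real (nval a s)"
| "rval \<delta> (RVar x) s = rvar s x"
| "rval \<delta> (RCell x i) s = rarr s x (nval i s)"
| "rval \<delta> (Dist i j) s = \<delta> (nval i s) (nval j s)"
| "rval \<delta> (RAdd a b) s = rval \<delta> a s + rval \<delta> b s"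
| "rval \<delta> (RSub a b) s = rval \<delta> a s - rval \<delta> b s"
| "rval \<delta> (RMul a b) s = rval \<delta> a s * rval \<delta> b s"
| "rval \<delta> (RDiv a b) s = rval \<delta> a s / rval \<delta> b s"

fun rcost :: "rexp \<Rightarrow> nat" where
  "rcost (OfNat a) = 1 + ncost a"
| "rcost (RVar x) = 1"
| "rcost (RCell x i) = 1 + ncost i"
| "rcost (Dist i j) = 1 + ncost i + ncost j"
| "rcost (RAdd a b) = 1 + rcost a + rcost b"
| "rcost (RSub a b) = 1 + rcost a + rcost b"
| "rcost (RMul a b) = 1 + rcost a + rcost b"
| "rcost (RDiv a b) = 1 + rcost a + rcost b"

fun bval :: "(nat \<Rightarrow> nat \<Rightarrow> real) \<Rightarrow> bexp \<Rightarrow> state \<Rightarrow> bool" where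
  "bval \<delta> (NLess a b) s = (nval a s < nval b s)"
| "bval \<delta> (NEq a b) s = (nval a s = nval b s)"
| "bval \<delta> (RLess a b) s = (rval \<delta> a s < rval \<delta> b s)"
| "bval \<delta> (REq a b) s = (rval \<delta> a s = rval \<delta> b s)"
| "bval \<delta> (BNot b) s = (\<not> bval \<delta> b s)"
| "bval \<delta> (BAnd a b) s = (bval \<delta> a s \<and> bval \<delta> b s)"

fun bcost :: "bexp \<Rightarrow> nat" where
  "bcost (NLess a b) = 1 + ncost a + ncost b"
| "bcost (NEq a b) = 1 + ncost a + ncost b"
| "bcost (RLess a b) = 1 + rcost a + rcost b"
| "bcost (REq a b) = 1 + rcost a + rcost b"
| "bcost (BNot b) = 1 + bcost b"
| "bcost (BAnd a b) = 1 + bcost a + bcost b"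

text \<open>\<open>exec \<delta> c s t s'\<close>: with distance oracle \<open>\<delta>\<close>, program \<open>c\<close> started in state \<open>s\<close> halts in
  state \<open>s'\<close> after \<open>t\<close> units of time.\<close>

inductive exec :: "(nat \<Rightarrow> nat \<Rightarrow> real) \<Rightarrow> com \<Rightarrow> state \<Rightarrow> nat \<Rightarrow> state \<Rightarrow> bool"
  for \<delta> :: "nat \<Rightarrow> nat \<Rightarrow> real" where
  Skip: "exec \<delta> Skip s 1 s"
| NAssign: "exec \<delta> (NAssign x a) s (1 + ncost a)
    (s\<lparr>nvar := (nvar s)(x := nval a s)\<rparr>)"
| NStore: "exec \<delta> (NStore x i a) s (1 + ncost i + ncost a)
    (s\<lparr>narr := (narr s)(x := (narr s x)(nval i s := nval a s))\<rparr>)"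
| RAssign: "exec \<delta> (RAssign x a) s (1 + rcost a)
    (s\<lparr>rvar := (rvar s)(x := rval \<delta> a s)\<rparr>)"
| RStore: "exec \<delta> (RStore x i a) s (1 + ncost i + rcost a)
    (s\<lparr>rarr := (rarr s)(x := (rarr s x)(nval i s := rval \<delta> a s))\<rparr>)"
| Seq: "exec \<delta> c1 s t1 s1 \<Longrightarrow> exec \<delta> c2 s1 t2 s2 \<Longrightarrow> exec \<delta> (Seq c1 c2) s (t1 + t2) s2"
| CondTrue: "bval \<delta> b s \<Longrightarrow> exec \<delta> c1 s t s1 \<Longrightarrow> exec \<delta> (Cond b c1 c2) s (1 + bcost b + t) s1"
| CondFalse: "\<not> bval \<delta> b s \<Longrightarrow> exec \<delta> c2 s t s1 \<Longrightarrow> exec \<delta> (Cond b c1 c2) s (1 + bcost b + t) s1"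
| LoopFalse: "\<not> bval \<delta> b s \<Longrightarrow> exec \<delta> (Loop b c) s (1 + bcost b) s"
| LoopTrue: "bval \<delta> b s \<Longrightarrow> exec \<delta> c s t1 s1 \<Longrightarrow> exec \<delta> (Loop b c) s1 t2 s2
    \<Longrightarrow> exec \<delta> (Loop b c) s (1 + bcost b + t1 + t2) s2"

inductive_cases exec_SkipE: "exec \<delta> Skip s t s'"
  and exec_NAssignE: "exec \<delta> (NAssign x a) s t s'"
  and exec_NStoreE: "exec \<delta> (NStore x i a) s t s'"
  and exec_RAssignE: "exec \<delta> (RAssign x e) s t s'"
  and exec_RStoreE: "exec \<delta> (RStore x i e) s t s'"
  and exec_SeqE: "exec \<delta> (Seq c1 c2) s t s'"
  and exec_CondE: "exec \<delta> (Cond b c1 c2) s t s'"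
  and exec_LoopE: "exec \<delta> (Loop b c) s t s'"

text \<open>Result and running time are determined by the program and the initial state.\<close>

lemma exec_deterministic:
  "exec \<delta> c s t s' \<Longrightarrow> exec \<delta> c s u s'' \<Longrightarrow> t = u \<and> s' = s''"
proof (induction arbitrary: u s'' rule: exec.induct)
  case (Seq c1 s t1 s1 c2 t2 s2)
  from Seq.prems obtain u1 u2 r where r: "u = u1 + u2" "exec \<delta> c1 s u1 r" "exec \<delta> c2 r u2 s''"
    by (rule exec_SeqE)
  from Seq.IH(1)[OF r(2)] have "t1 = u1" "s1 = r" by simp_all
  with Seq.IH(2)[of u2 s''] r show ?case by simp
next
  case (CondTrue b s c1 t s1 c2)
  from CondTrue.prems obtain v where v: "u = 1 + bcost b + v" "exec \<delta> c1 s v s''"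
    by (rule exec_CondE) (use CondTrue.hyps in simp_all)
  from CondTrue.IH[OF v(2)] v(1) show ?case by simp
next
  case (CondFalse b s c2 t s1 c1)
  from CondFalse.prems obtain v where v: "u = 1 + bcost b + v" "exec \<delta> c2 s v s''"
    by (rule exec_CondE) (use CondFalse.hyps in simp_all)
  from CondFalse.IH[OF v(2)] v(1) show ?case by simp
next
  case (LoopFalse b s c)
  from LoopFalse.prems show ?case by (rule exec_LoopE) (use LoopFalse.hyps in simp_all)
next
  case (LoopTrue b s c t1 s1 t2 s2)
  from LoopTrue.prems obtain u1 u2 r where
    r: "u = 1 + bcost b + u1 + u2" "exec \<delta> c s u1 r" "exec \<delta> (Loop b c) r u2 s''"
    by (rule exec_LoopE) (use LoopTrue.hyps in simp_all)
  from LoopTrue.IH(1)[OF r(2)] have "t1 = u1" "s1 = r" by simp_all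
  with LoopTrue.IH(2)[of u2 s''] r show ?case by simp
qed (auto elim: exec_SkipE exec_NAssignE exec_NStoreE exec_RAssignE exec_RStoreE)


section \<open>Input and output encoding\<close>

text \<open>Points are presented as indices \<open>0, \<dots>, n - 1\<close> through an enumeration \<open>pts\<close> of \<open>X\<close>; the metric
  is accessible only through the oracle. Memory holds the numbers \<open>n\<close> and \<open>m\<close>, the required counts,
  the group number of each point and the accuracy parameter, and is zero elsewhere.\<close>

definition oracle_of :: "('a \<Rightarrow> 'a \<Rightarrow> real) \<Rightarrow> (nat \<Rightarrow> 'a) \<Rightarrow> nat \<Rightarrow> nat \<Rightarrow> real" where
  "oracle_of d pts i j = d (pts i) (pts j)"

definition input_state ::
    "nat \<Rightarrow> nat \<Rightarrow> (nat \<Rightarrow> 'a set) \<Rightarrow> (nat \<Rightarrow> nat) \<Rightarrow> (nat \<Rightarrow> 'a) \<Rightarrow> real \<Rightarrow> state" where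
  "input_state n m G ks pts \<epsilon> =
     \<lparr>nvar = (\<lambda>_. 0)(''n'' := n, ''m'' := m),
      narr = (\<lambda>_ _. 0)(''count'' := (\<lambda>i. if i < m then ks i else 0),
                       ''group'' := (\<lambda>p. if p < n then (THE i. i < m \<and> pts p \<in> G i) else 0)),
      rvar = (\<lambda>_. 0)(''eps'' := \<epsilon>),
      rarr = (\<lambda>_ _. 0)\<rparr>"

text \<open>The returned set is given by its characteristic vector.\<close>

definition output_set :: "nat \<Rightarrow> (nat \<Rightarrow> 'a) \<Rightarrow> state \<Rightarrow> 'a set" where
  "output_set n pts s = pts ` {p. p < n \<and> narr s ''out'' p \<noteq> 0}"

end

theory Submission
  imports Defs
begin

text \<open>For a threshold \<open>\<tau>\<close>, grow rainbow clusters greedily: start from any uncovered point and keep adding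
  points at distance less than \<open>\<tau>\<close> from the cluster whose colour is new to it; when none is left, the cluster
  covers every point within distance \<open>\<tau>\<close> of it. A colour is dropped once \<open>k\<close> clusters contain it, so
  there are at most \<open>k m\<close> chosen points. Points chosen in different clusters are at distance at least \<open>\<tau>\<close>,
  and a cluster has diameter at most \<open>(m - 1) \<tau>\<close>. Hence if a fair set has diversity at least \<open>(m + 1) \<tau>\<close>,
  its points are covered by distinct clusters, each containing the colour of the point it covers, and
  Hall's condition holds for assigning clusters to colours; the dropped colours satisfy it trivially.
  A push-relabel matching then selects \<open>ks i\<close> clusters for each colour \<open>i\<close> within \<open>O(k m\<^sup>2)\<close>
  scans of the points.

  Every distance is at most \<open>2 r\<close>, where \<open>r\<close> is the largest distance from the first point. The program
  tries \<open>(m + 1) \<tau> = 2 r / (1 + \<epsilon>) ^ j\<close> for \<open>j = 0, 1, \<dots>\<close> until it succeeds, which happens at the latest when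
  this value drops to the optimum; the aspect ratio bounds the number of attempts by \<open>O(\<epsilon>\<^sup>-\<^sup>1 log n)\<close>.\<close>

section \<open>Rainbow clusters\<close>

text \<open>The optimum and the aspect ratio are unknown to the program, so every attempt must be
  self-certifying: success yields a fair set separated by \<tau>, failure refutes every fair set
  separated by \<open>(m + 1) * \<tau>\<close>. The loss \<open>m + 1\<close> is
  \<open>(m - 1) + 2\<close>: the diameter of a cluster with one member per colour, plus a step
  shorter than \<tau> at each end, from a covered point to the member that covers it. Dropping a
  colour after \<open>k\<close> clusters costs nothing in Hall's condition, because the total demand
  of any set of colours is at most \<open>k\<close>; it is what keeps the number of scans
  independent of \<open>n\<close>. The matching has to be driven by plain scans too. Labels achieve
  this: each takeover raises the sum of the cluster keys, each key is at most \<open>m\<close>, and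
  there are at most \<open>k * m\<close> clusters with chosen points. The largest distance from one
  point needs only \<open>n\<close> evaluations, whereas the exact diameter would need quadratically
  many; the factor 2 lost affects only the number of attempts.\<close>

locale indexed_instance =
  fixes n m k :: nat and g ks :: "nat \<Rightarrow> nat" and \<delta> :: "nat \<Rightarrow> nat \<Rightarrow> real"
  assumes colour_less: "q < n \<Longrightarrow> g q < m"
    and total_count: "k = (\<Sum>i<m. ks i)"
    and dist_same: "q < n \<Longrightarrow> \<delta> q q = 0"
    and dist_sym: "p < n \<Longrightarrow> q < n \<Longrightarrow> \<delta> p q = \<delta> q p"
    and dist_triangle: "p < n \<Longrightarrow> q < n \<Longrightarrow> r < n \<Longrightarrow> \<delta> p r \<le> \<delta> p q + \<delta> q r"

text \<open>Counts are exact, as in the definition of the optimum. All fair index sets then have the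
  same cardinality, which settles the case of infinite optimal diversity.\<close>

definition fair_indices :: "nat \<Rightarrow> nat \<Rightarrow> (nat \<Rightarrow> nat) \<Rightarrow> (nat \<Rightarrow> nat) \<Rightarrow> nat set \<Rightarrow> bool" where
  "fair_indices n m g ks M \<longleftrightarrow> M \<subseteq> {..<n} \<and> (\<forall>i<m. card {q \<in> M. g q = i} = ks i)"

text \<open>A real-valued substitute for lower bounds on \<open>diversity\<close>. Sets with at most
  one point satisfy it for every threshold, so infinite diversity stays out of the analysis of the
  program.\<close>

definition separated :: "(nat \<Rightarrow> nat \<Rightarrow> real) \<Rightarrow> real \<Rightarrow> nat set \<Rightarrow> bool" where
  "separated \<delta> \<tau> M \<longleftrightarrow> (\<forall>p\<in>M. \<forall>q\<in>M. p \<noteq> q \<longrightarrow> \<tau> \<le> \<delta> p q)"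

lemma card_eq_sum_colours:
  fixes M :: "nat set" and V :: "nat set"
  assumes "finite M" "finite V"
  shows "card {q \<in> M. g q \<in> V} = (\<Sum>i\<in>V. card {q \<in> M. g q = i})"
proof -
  have "{q \<in> M. g q \<in> V} = (\<Union>i\<in>V. {q \<in> M. g q = i})" by auto
  also have "card \<dots> = (\<Sum>i\<in>V. card {q \<in> M. g q = i})"
    by (rule card_UN_disjoint) (use assms in auto)
  finally show ?thesis .
qed

text \<open>Clusters are numbered from \<open>1\<close> in order of creation and \<open>c\<close> is the current one. \<open>mark q\<close> is the cluster
  that covers \<open>q\<close> (\<open>0\<close> if none), \<open>E\<close> is the set of chosen points, \<open>cnt i\<close> the number of clusters with
  colour \<open>i\<close>, and \<open>last i\<close> the latest of them.\<close>

locale clustering = indexed_instance +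
  fixes \<tau> :: real and mark ch cnt last :: "nat \<Rightarrow> nat" and c :: nat and E
  defines "E \<equiv> {q. q < n \<and> ch q \<noteq> 0}"
  assumes mark_le: "q < n \<Longrightarrow> mark q \<le> c"
    and mark_chosen: "q \<in> E \<Longrightarrow> mark q \<noteq> 0"
    and cnt_eq: "i < m \<Longrightarrow> cnt i = card {q \<in> E. g q = i}"
    and cnt_le: "i < m \<Longrightarrow> cnt i \<le> k"
    and rainbow: "p \<in> E \<Longrightarrow> q \<in> E \<Longrightarrow> mark p = mark q \<Longrightarrow> g p = g q \<Longrightarrow> p = q"
    and last_le: "i < m \<Longrightarrow> last i \<le> c"
    and last_ge: "q \<in> E \<Longrightarrow> mark q \<le> last (g q)"
    and last_attained: "i < m \<Longrightarrow> last i \<noteq> 0 \<Longrightarrow> \<exists>q\<in>E. g q = i \<and> mark q = last i"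
    and far: "p \<in> E \<Longrightarrow> q < n \<Longrightarrow> mark q = 0 \<or> mark p < mark q \<Longrightarrow> \<tau> \<le> \<delta> p q"
    and near: "q < n \<Longrightarrow> mark q \<noteq> 0 \<Longrightarrow> \<exists>p\<in>E. mark p = mark q \<and> \<delta> p q < \<tau>"
    and diam: "p \<in> E \<Longrightarrow> q \<in> E \<Longrightarrow> mark p = mark q \<Longrightarrow>
      \<delta> p q \<le> (real (card {r \<in> E. mark r = mark p}) - 1) * \<tau>"
    and complete: "q < n \<Longrightarrow> mark q \<noteq> 0 \<Longrightarrow> mark q < c \<Longrightarrow>
      k \<le> cnt (g q) \<or> (\<exists>p\<in>E. mark p = mark q \<and> g p = g q)"
    and threshold_pos: "0 < \<tau>"
begin

lemma finite_E: "finite E" and E_less: "q \<in> E \<Longrightarrow> q < n"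
  unfolding E_def by auto

lemma inj_mark: "inj_on mark {q \<in> E. g q = i}" and inj_colour: "inj_on g {q \<in> E. mark q = v}"
  using rainbow by (simp_all add: inj_on_def)

text \<open>Every scan but the last adds a chosen point, so this bounds the number of rounds of the
  cluster construction.\<close>

lemma card_E_le: "card E \<le> k * m"
proof -
  have "E = {q \<in> E. g q \<in> {..<m}}" using E_less colour_less by auto
  then have "card E = (\<Sum>i<m. card {q \<in> E. g q = i})"
    using card_eq_sum_colours[OF finite_E, of "{..<m}" g] by simp
  also have "\<dots> \<le> (\<Sum>i<m. k)"
    by (rule sum_mono) (use cnt_eq cnt_le in auto)
  finally show ?thesis by (simp add: mult.commute)
qed

text \<open>Only \<open>complete\<close> changes its meaning when \<open>c\<close> grows: it now
  also speaks of the cluster just closed. If the colour of a point there is not dropped, its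
  \<open>last\<close> entry equals \<open>c\<close>, and \<open>last_attained\<close> supplies the
  member of that colour.\<close>

lemma next_cluster:
  assumes cl: "\<And>q. q < n \<Longrightarrow> mark q = c \<Longrightarrow> c \<noteq> 0 \<Longrightarrow> cnt (g q) < k \<Longrightarrow> c \<le> last (g q)"
  shows "clustering n m k g ks \<delta> \<tau> mark ch cnt last (Suc c)"
proof (unfold_locales; (fold E_def)?)
  fix q assume q: "q < n" "mark q \<noteq> 0" "mark q < Suc c"
  show "k \<le> cnt (g q) \<or> (\<exists>p\<in>E. mark p = mark q \<and> g p = g q)"
  proof (cases "mark q < c")
    case True then show ?thesis using complete q by blast
  next
    case False
    then have e: "mark q = c" "c \<noteq> 0" using q by auto
    show ?thesis
    proof (cases "cnt (g q) < k")
      case True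
      then have "last (g q) = c" using cl[OF q(1) e] last_le colour_less[OF q(1)] by (simp add: le_antisym)
      then show ?thesis using last_attained[of "g q"] e colour_less[OF q(1)] by auto
    qed simp
  qed
qed (use mark_le mark_chosen cnt_eq cnt_le rainbow last_le last_ge last_attained far near diam threshold_pos
     in \<open>auto intro: le_SucI\<close>)

text \<open>The two alternatives in \<open>start\<close> are growing the current cluster by a point
  it already covers and opening it with an uncovered point. Comparing \<open>last (g p)\<close> with
  \<open>c\<close> tests in constant time whether the colour is new to the cluster, with no table to
  clear per cluster.\<close>

lemma add_point:
  assumes p: "p < n" "cnt (g p) < k" "last (g p) < c"
    and start: "mark p = c \<or> mark p = 0 \<and> (\<forall>q\<in>E. mark q \<noteq> c)"
  defines "mark' \<equiv> \<lambda>q. if q < n \<and> mark q = 0 \<and> \<delta> p q < \<tau> then c else mark q"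
  shows "clustering n m k g ks \<delta> \<tau> mark' (ch(p := 1)) (cnt(g p := Suc (cnt (g p)))) (last(g p := c)) c"
    and "{q. q < n \<and> (ch(p := 1)) q \<noteq> 0} = insert p E" and "p \<notin> E"
proof -
  show E': "{q. q < n \<and> (ch(p := 1)) q \<noteq> 0} = insert p E" using p by (auto simp: E_def)
  show pE: "p \<notin> E"
    using mark_chosen[of p] last_ge[of p] start p by auto
  have c0: "c \<noteq> 0" using p by auto
  have old: "mark' q = mark q" if "q \<in> E" for q using mark_chosen[OF that] by (simp add: mark'_def)
  \<comment> \<open>If \<open>p\<close> opens the cluster it was uncovered, and it lies in its own
    ball because its distance to itself is 0.\<close>
  have mp: "mark' p = c" using start p dist_same threshold_pos by (auto simp: mark'_def)
  have keep: "mark' q = mark q" if "mark q \<noteq> 0" for q using that by (simp add: mark'_def)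
  have noc: "g q \<noteq> g p" if "q \<in> E" "mark q = c" for q
    using last_ge[OF that(1)] that p by auto
  have cl: "{r \<in> insert p E. mark' r = mark' q} =
      (if mark q = c then insert p {r \<in> E. mark r = mark q} else {r \<in> E. mark r = mark q})" if "q \<in> E" for q
    using old mp that by auto
  have clp: "{r \<in> insert p E. mark' r = mark' p} = insert p {r \<in> E. mark r = c}"
    using old mp by auto
  have fin: "finite {r \<in> E. mark r = v}" for v using finite_E by simp
  have cardc: "card (insert p {r \<in> E. mark r = v}) = Suc (card {r \<in> E. mark r = v})" for v
    using fin pE by simp
  \<comment> \<open>A cluster with members is joined only by a point it already covers, so some
    member \<open>r\<close> is within \<tau> of \<open>p\<close>. The detour through
    \<open>r\<close> costs one extra \<tau>, exactly what one extra member allows in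
    \<open>diam\<close>.\<close>
  have new: "\<delta> q p \<le> real (card {r \<in> E. mark r = c}) * \<tau>" if q: "q \<in> E" "mark q = c" for q
  proof -
    have "mark p = c" using start q by auto
    then obtain r where r: "r \<in> E" "mark r = c" "\<delta> r p < \<tau>" using near[OF p(1)] c0 by auto
    have "\<delta> q p \<le> \<delta> q r + \<delta> r p" using dist_triangle q r p E_less by auto
    also have "\<dots> \<le> (real (card {r \<in> E. mark r = c}) - 1) * \<tau> + \<tau>"
      using diam[OF q(1) r(1)] q r by auto
    finally show ?thesis by (simp add: algebra_simps)
  qed
  show "clustering n m k g ks \<delta> \<tau> mark' (ch(p := 1)) (cnt(g p := Suc (cnt (g p)))) (last(g p := c)) c"
  proof (unfold_locales; (unfold E')?)
    show "mark' q \<le> c" if "q < n" for q using mark_le[OF that] by (simp add: mark'_def)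
    show "mark' q \<noteq> 0" if "q \<in> insert p E" for q using that old mp mark_chosen c0 by auto
    show "(cnt(g p := Suc (cnt (g p)))) i = card {q \<in> insert p E. g q = i}" if "i < m" for i
    proof (cases "i = g p")
      case True
      have "{q \<in> insert p E. g q = i} = insert p {q \<in> E. g q = i}" using True by auto
      then show ?thesis using True cnt_eq[OF that] finite_E pE by simp
    next
      case False
      then have "{q \<in> insert p E. g q = i} = {q \<in> E. g q = i}" by auto
      then show ?thesis using False cnt_eq[OF that] by simp
    qed
    show "(cnt(g p := Suc (cnt (g p)))) i \<le> k" if "i < m" for i
      using cnt_le[OF that] p by auto
    show "q = r" if "q \<in> insert p E" "r \<in> insert p E" "mark' q = mark' r" "g q = g r" for q r
      using that rainbow noc old mp by (metis insert_iff)
    show "(last(g p := c)) i \<le> c" if "i < m" for i using last_le[OF that] by simp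
    show "mark' q \<le> (last(g p := c)) (g q)" if "q \<in> insert p E" for q
      using that old mp last_ge mark_le E_less by auto
    show "\<exists>q\<in>insert p E. g q = i \<and> mark' q = (last(g p := c)) i"
      if "i < m" "(last(g p := c)) i \<noteq> 0" for i
      using that last_attained[of i] old mp by (cases "i = g p") auto
    show "\<tau> \<le> \<delta> r q" if "r \<in> insert p E" "q < n" "mark' q = 0 \<or> mark' r < mark' q" for r q
    proof (cases "r = p")
      case True
      \<comment> \<open>No mark exceeds \<open>c\<close>, so only points that remain uncovered
        matter, and those lie outside the ball around \<open>p\<close>.\<close>
      then show ?thesis using that mp mark_le[of q] c0 by (auto simp: mark'_def split: if_splits)
    next
      case False
      then have "r \<in> E" using that by auto
      \<comment> \<open>A point covered only now had mark 0 before, so the old invariant already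
        kept it away from every earlier chosen point.\<close>
      then show ?thesis using far[of r q] that old by (auto simp: mark'_def split: if_splits)
    qed
    show "\<exists>r\<in>insert p E. mark' r = mark' q \<and> \<delta> r q < \<tau>" if "q < n" "mark' q \<noteq> 0" for q
    proof (cases "mark q = 0")
      case True
      then have "mark' q = c" "\<delta> p q < \<tau>" using that by (auto simp: mark'_def split: if_splits)
      then show ?thesis using mp by auto
    next
      case False
      then show ?thesis using near[of q] that old keep by (metis insertCI)
    qed
    show "\<delta> q r \<le> (real (card {x \<in> insert p E. mark' x = mark' q}) - 1) * \<tau>"
      if qr: "q \<in> insert p E" "r \<in> insert p E" "mark' q = mark' r" for q r
    proof -
      consider "q = p" "r = p" | "q = p" "r \<in> E" "mark r = c" | "q \<in> E" "r = p" "mark q = c"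
        | "q \<in> E" "r \<in> E" "mark q = mark r"
        using qr(1,2) qr(3) old[of q] old[of r] mp by (metis insert_iff)
      then show ?thesis
      proof cases
        case 1 then show ?thesis using dist_same p threshold_pos clp cardc by simp
      next
        case 2 then show ?thesis using new[of r] dist_sym[of p r] p E_less clp cardc by simp
      next
        case 3 then show ?thesis using new[of q] cl[of q] cardc by simp
      next
        case 4
        have "\<delta> q r \<le> (real (card {x \<in> E. mark x = mark q}) - 1) * \<tau>" using diam 4 by auto
        then show ?thesis using cl[of q] 4 cardc threshold_pos by (auto simp: algebra_simps)
      qed
    qed
    show "k \<le> (cnt(g p := Suc (cnt (g p)))) (g q) \<or> (\<exists>r\<in>insert p E. mark' r = mark' q \<and> g r = g q)"
      if "q < n" "mark' q \<noteq> 0" "mark' q < c" for q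
    proof -
      have "mark' q = mark q" using that by (auto simp: mark'_def split: if_splits)
      then show ?thesis using complete[of q] that old by (auto; metis)
    qed
    show "0 < \<tau>" by (rule threshold_pos)
  qed
qed

text \<open>If \<open>V\<close> contains a dropped colour, that colour alone occurs in
  \<open>k\<close> clusters, enough for the total demand. Otherwise \<open>mark\<close> sends the
  points of \<open>M\<close> with colours in \<open>V\<close> injectively to closed clusters that
  contain their colours; a collision would put two of them too close together.\<close>

lemma hall:
  assumes exhausted: "\<And>q. q < n \<Longrightarrow> cnt (g q) < k \<Longrightarrow> mark q \<noteq> 0 \<and> mark q \<noteq> c"
    and O: "fair_indices n m g ks M" "separated \<delta> ((real m + 1) * \<tau>) M"
    and V: "V \<subseteq> {..<m}"
  shows "(\<Sum>i\<in>V. ks i) \<le> card (mark ` {p \<in> E. g p \<in> V})"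
proof (cases "\<exists>i\<in>V. k \<le> cnt i")
  case True
  then obtain i where i: "i \<in> V" "k \<le> cnt i" by auto
  have "(\<Sum>i\<in>V. ks i) \<le> k" unfolding total_count by (rule sum_mono2) (use V in auto)
  also have "k \<le> card {q \<in> E. g q = i}" using i cnt_eq V by auto
  also have "\<dots> = card (mark ` {q \<in> E. g q = i})"
    by (rule card_image[OF inj_mark, symmetric])
  also have "\<dots> \<le> card (mark ` {p \<in> E. g p \<in> V})"
    by (rule card_mono) (use i finite_E in auto)
  finally show ?thesis .
next
  case False
  have M: "M \<subseteq> {..<n}" "finite M" using O(1) by (auto simp: fair_indices_def intro: finite_subset)
  have fV: "finite V" using V by (rule finite_subset) simp
  have rep: "mark q \<noteq> 0 \<and> (\<exists>p\<in>E. mark p = mark q \<and> g p = g q)" if "q \<in> M" "g q \<in> V" for q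
  proof -
    have q: "q < n" "cnt (g q) < k" using that M False by auto
    then have "mark q \<noteq> 0" "mark q < c" using exhausted[OF q] mark_le[OF q(1)] by auto
    then show ?thesis using complete[OF q(1)] q(2) by auto
  qed
  have inj: "inj_on mark {q \<in> M. g q \<in> V}"
  proof (rule inj_onI, rule ccontr)
    fix q r assume q: "q \<in> {q \<in> M. g q \<in> V}" and r: "r \<in> {q \<in> M. g q \<in> V}"
      and e: "mark q = mark r" and ne: "q \<noteq> r"
    have lt: "q < n" "r < n" using q r M by auto
    obtain p where p: "p \<in> E" "mark p = mark q" "\<delta> p q < \<tau>" using near[of q] rep[of q] q lt by auto
    obtain p' where p': "p' \<in> E" "mark p' = mark q" "\<delta> p' r < \<tau>"
      using near[of r] rep[of r] r lt e by auto
    \<comment> \<open>Colours are distinct within a cluster, so it has at most \<open>m\<close>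
      members and \<open>diam\<close> becomes \<open>(m - 1) * \<tau>\<close>.\<close>
    have "card {r \<in> E. mark r = mark p} = card (g ` {r \<in> E. mark r = mark p})"
      by (rule card_image[OF inj_colour, symmetric])
    also have "\<dots> \<le> card {..<m}" by (rule card_mono) (use colour_less E_less in auto)
    finally have "real (card {r \<in> E. mark r = mark p}) - 1 \<le> real m - 1" by simp
    then have "(real (card {r \<in> E. mark r = mark p}) - 1) * \<tau> \<le> (real m - 1) * \<tau>"
      using threshold_pos by (simp add: mult_right_mono)
    then have "\<delta> p p' \<le> (real m - 1) * \<tau>" using diam[of p p'] p p' by auto
    moreover have "\<delta> q r \<le> \<delta> q p + \<delta> p r" using dist_triangle lt p E_less by auto
    moreover have "\<delta> p r \<le> \<delta> p p' + \<delta> p' r" using dist_triangle lt p p' E_less by auto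
    moreover have "\<delta> q p = \<delta> p q" using dist_sym lt p E_less by auto
    \<comment> \<open>The path from \<open>q\<close> to \<open>p\<close> to \<open>p'\<close> to
      \<open>r\<close> has length below \<open>\<tau> + (m - 1) * \<tau> + \<tau>\<close>;
      strictness comes from the two covering steps.\<close>
    ultimately have "\<delta> q r < (real m + 1) * \<tau>" using p p' by (simp add: algebra_simps)
    then show False using O(2) q r ne by (force simp: separated_def)
  qed
  have "(\<Sum>i\<in>V. ks i) = (\<Sum>i\<in>V. card {q \<in> M. g q = i})"
    using O(1) V by (intro sum.cong) (auto simp: fair_indices_def)
  also have "\<dots> = card {q \<in> M. g q \<in> V}" using card_eq_sum_colours[OF M(2) fV] by simp
  also have "\<dots> = card (mark ` {q \<in> M. g q \<in> V})" using card_image[OF inj] by simp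
  also have "\<dots> \<le> card (mark ` {p \<in> E. g p \<in> V})"
  proof (rule card_mono)
    show "mark ` {q \<in> M. g q \<in> V} \<subseteq> mark ` {p \<in> E. g p \<in> V}"
      using rep by (auto simp: image_iff) metis
  qed (use finite_E in auto)
  finally show ?thesis .
qed

end

lemma (in indexed_instance) clustering_initial:
  fixes last :: "nat \<Rightarrow> nat"
  assumes "\<And>q. q < n \<Longrightarrow> mark q = 0" "\<And>q. q < n \<Longrightarrow> ch q = 0"
    "\<And>i. i < m \<Longrightarrow> cnt i = 0" "\<And>i. i < m \<Longrightarrow> last i = 0" "0 < \<tau>"
  shows "clustering n m k g ks \<delta> \<tau> mark ch cnt last 0"
  by unfold_locales (use assms in auto)

section \<open>Matching clusters to colours\<close>

text \<open>\<open>own v\<close> is \<open>Suc q\<close> if the point \<open>q\<close> is selected from cluster \<open>v\<close>, and \<open>0\<close> if none is; \<open>need i\<close> is the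
  number of points of colour \<open>i\<close> still missing. A colour in need takes over a cluster of minimal \<open>key\<close> among
  those offering it an unselected point, and raises its label \<open>h\<close> to that key.\<close>

locale selection =
  fixes n m :: nat and g ks :: "nat \<Rightarrow> nat" and E :: "nat set"
    and \<kappa> out own h need :: "nat \<Rightarrow> nat" and key
  defines "key \<equiv> \<lambda>v. if own v = 0 then 0 else Suc (h (g (own v - 1)))"
  assumes E_less: "q \<in> E \<Longrightarrow> q < n"
    and colour_less: "q < n \<Longrightarrow> g q < m"
    and rainbow: "p \<in> E \<Longrightarrow> q \<in> E \<Longrightarrow> \<kappa> p = \<kappa> q \<Longrightarrow> g p = g q \<Longrightarrow> p = q"
    and out_E: "q < n \<Longrightarrow> out q \<noteq> 0 \<Longrightarrow> q \<in> E"
    and own_out: "q \<in> E \<Longrightarrow> out q \<noteq> 0 \<longleftrightarrow> own (\<kappa> q) = Suc q"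
    and own_attained: "q \<in> E \<Longrightarrow> own (\<kappa> q) \<noteq> 0 \<Longrightarrow> \<exists>p\<in>E. \<kappa> p = \<kappa> q \<and> own (\<kappa> q) = Suc p"
    and label_less: "i < m \<Longrightarrow> h i < m"
    and need_eq: "i < m \<Longrightarrow> card {q \<in> E. out q \<noteq> 0 \<and> g q = i} + need i = ks i"
    and label_le: "q \<in> E \<Longrightarrow> out q = 0 \<Longrightarrow> h (g q) \<le> key (\<kappa> q)"
begin

lemma finite_E: "finite E"
  using E_less by (intro finite_subset[of E "{..<n}"]) auto

lemma key_le: "q \<in> E \<Longrightarrow> key (\<kappa> q) \<le> m"
  using own_attained[of q] label_less colour_less E_less by (auto simp: key_def Suc_le_eq)

lemma key_sum_le: "(\<Sum>v\<in>\<kappa> ` E. key v) \<le> m * card E"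
proof -
  have "(\<Sum>v\<in>\<kappa> ` E. key v) \<le> (\<Sum>v\<in>\<kappa> ` E. m)" by (rule sum_mono) (use key_le in auto)
  also have "\<dots> \<le> m * card E" using card_image_le[OF finite_E, of \<kappa>] by simp
  finally show ?thesis .
qed

text \<open>One push-relabel step. The new owner's label is the old key of the cluster, so that key
  grows by exactly one, while no label decreases and hence no other key does. Minimality of the key
  is what lets the raised label satisfy \<open>label_le\<close> for the other unselected points of
  the same colour.\<close>

lemma take_cluster:
  assumes p: "p \<in> E" "out p = 0" "0 < need (g p)" "key (\<kappa> p) < m"
    and cheapest: "\<And>q. q \<in> E \<Longrightarrow> out q = 0 \<Longrightarrow> g q = g p \<Longrightarrow> key (\<kappa> p) \<le> key (\<kappa> q)"
  defines "o1 \<equiv> if own (\<kappa> p) = 0 then out else out(own (\<kappa> p) - 1 := 0)"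
    and "n1 \<equiv> if own (\<kappa> p) = 0 then need
      else need(g (own (\<kappa> p) - 1) := Suc (need (g (own (\<kappa> p) - 1))))"
    and "own' \<equiv> own(\<kappa> p := Suc p)"
    and "h' \<equiv> h(g p := key (\<kappa> p))"
  shows "selection n m g ks E \<kappa> (o1(p := 1)) own' h' (n1(g p := n1 (g p) - 1))"
    and "(\<Sum>v\<in>\<kappa> ` E. key v) <
      (\<Sum>v\<in>\<kappa> ` E. if own' v = 0 then 0 else Suc (h' (g (own' v - 1))))"
proof -
  define out' where "out' = o1(p := 1)"
  define need' where "need' = n1(g p := n1 (g p) - 1)"
  define key' where "key' = (\<lambda>v. if own' v = 0 then 0 else Suc (h' (g (own' v - 1))))"
  \<comment> \<open>Applying \<open>label_le\<close> to the still unselected \<open>p\<close> shows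
    that relabelling never lowers a label.\<close>
  have h'_ge: "h i \<le> h' i" for i using label_le p by (simp add: h'_def)
  have key'_p: "key' (\<kappa> p) = Suc (key (\<kappa> p))" by (simp add: key'_def own'_def h'_def)
  have key'_ge: "key v \<le> key' v" for v
    using h'_ge key'_p by (cases "v = \<kappa> p") (auto simp: key'_def key_def own'_def)
  have "(\<Sum>v\<in>\<kappa> ` E. key v) < (\<Sum>v\<in>\<kappa> ` E. key' v)"
    by (rule sum_strict_mono_ex1) (use finite_E key'_ge key'_p p(1) in \<open>auto intro!: bexI[of _ p]\<close>)
  then show "(\<Sum>v\<in>\<kappa> ` E. key v) <
      (\<Sum>v\<in>\<kappa> ` E. if own' v = 0 then 0 else Suc (h' (g (own' v - 1))))"
    by (simp add: key'_def)
  \<comment> \<open>A cluster has one point per colour, so an evicted owner has a colour other than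
    \<open>g p\<close>. The increment and the decrement of \<open>need\<close> therefore hit
    different entries.\<close>
  have owner: "out r \<noteq> 0 \<and> r \<noteq> p \<and> g r \<noteq> g p"
    if "r \<in> E" "\<kappa> r = \<kappa> p" "own (\<kappa> p) = Suc r" for r
    using that own_out[of r] own_out[of p] p rainbow[of r p] by auto
  have out': "out' q \<noteq> 0 \<longleftrightarrow> q = p \<or> out q \<noteq> 0 \<and> \<kappa> q \<noteq> \<kappa> p" if "q \<in> E" for q
    using that own_out[of q] own_attained[of p] p owner by (auto simp: out'_def o1_def)
  have count': "card {q \<in> E. out' q \<noteq> 0 \<and> g q = i} + need' i = ks i" if i: "i < m" for i
  proof (cases "own (\<kappa> p) = 0")
    case True
    have o': "out' q \<noteq> 0 \<longleftrightarrow> q = p \<or> out q \<noteq> 0" if "q \<in> E" for q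
      by (simp add: out'_def o1_def True)
    show ?thesis
    proof (cases "i = g p")
      case eq: True
      have "{q \<in> E. out' q \<noteq> 0 \<and> g q = i} = insert p {q \<in> E. out q \<noteq> 0 \<and> g q = i}"
        using o' p eq by auto
      then show ?thesis using need_eq[OF i] finite_E p eq True by (simp add: need'_def n1_def)
    next
      case ne: False
      have "{q \<in> E. out' q \<noteq> 0 \<and> g q = i} = {q \<in> E. out q \<noteq> 0 \<and> g q = i}" using o' ne by auto
      then show ?thesis using need_eq[OF i] ne True by (simp add: need'_def n1_def)
    qed
  next
    case False
    then obtain r where r: "r \<in> E" "\<kappa> r = \<kappa> p" "own (\<kappa> p) = Suc r" using own_attained[of p] p by auto
    note ow = owner[OF r]
    have o': "out' q \<noteq> 0 \<longleftrightarrow> q = p \<or> out q \<noteq> 0 \<and> q \<noteq> r" if "q \<in> E" for q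
      using r by (auto simp: out'_def o1_def)
    have need': "need' = need(g r := Suc (need (g r)), g p := need (g p) - 1)"
      using ow r by (simp add: need'_def n1_def)
    consider "i = g p" | "i = g r" "i \<noteq> g p" | "i \<noteq> g p" "i \<noteq> g r" by blast
    then show ?thesis
    proof cases
      case 1
      have "{q \<in> E. out' q \<noteq> 0 \<and> g q = i} = insert p {q \<in> E. out q \<noteq> 0 \<and> g q = i}"
        using o' p ow 1 by auto
      then show ?thesis using need_eq[OF i] finite_E p 1 need' by simp
    next
      case 2
      have e: "{q \<in> E. out q \<noteq> 0 \<and> g q = i} = insert r {q \<in> E. out' q \<noteq> 0 \<and> g q = i}"
        using o' p ow 2 r by auto
      have "r \<notin> {q \<in> E. out' q \<noteq> 0 \<and> g q = i}" using o' ow by auto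
      then have "card {q \<in> E. out q \<noteq> 0 \<and> g q = i} = Suc (card {q \<in> E. out' q \<noteq> 0 \<and> g q = i})"
        unfolding e using finite_E by (intro card_insert_disjoint) auto
      then show ?thesis using need_eq[OF i] 2 need' by simp
    next
      case 3
      have "{q \<in> E. out' q \<noteq> 0 \<and> g q = i} = {q \<in> E. out q \<noteq> 0 \<and> g q = i}" using o' 3 by auto
      then show ?thesis using need_eq[OF i] 3 need' by simp
    qed
  qed
  have label': "h' (g q) \<le> key' (\<kappa> q)" if q: "q \<in> E" "out' q = 0" for q
  proof (cases "out q = 0")
    case True
    have "h' (g q) \<le> key (\<kappa> q)"
      using label_le[OF q(1) True] cheapest[OF q(1) True] by (simp add: h'_def)
    then show ?thesis using key'_ge le_trans by blast
  next
    case False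
    then have "\<kappa> q = \<kappa> p" "own (\<kappa> p) = Suc q" using out'[OF q(1)] q own_out[OF q(1)] by auto
    \<comment> \<open>The point just evicted: as owner it had given its cluster the key
      \<open>Suc (h (g q))\<close>, and keys only grow.\<close>
    then have "h (g q) \<le> key (\<kappa> q)" "g q \<noteq> g p"
      using owner[OF q(1)] by (auto simp: key_def)
    then show ?thesis using key'_ge[of "\<kappa> q"] by (simp add: h'_def)
  qed
  have "selection n m g ks E \<kappa> out' own' h' need'"
  proof
    show "q < n" if "q \<in> E" for q using E_less that .
    show "g q < m" if "q < n" for q using colour_less that .
    show "q = r" if "q \<in> E" "r \<in> E" "\<kappa> q = \<kappa> r" "g q = g r" for q r using rainbow that .
    show "q \<in> E" if "q < n" "out' q \<noteq> 0" for q
      using that out_E[of q] p by (auto simp: out'_def o1_def split: if_splits)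
    show "out' q \<noteq> 0 \<longleftrightarrow> own' (\<kappa> q) = Suc q" if "q \<in> E" for q
      using out'[OF that] own_out[OF that] by (auto simp: own'_def)
    show "\<exists>r\<in>E. \<kappa> r = \<kappa> q \<and> own' (\<kappa> q) = Suc r"
      if "q \<in> E" "own' (\<kappa> q) \<noteq> 0" for q
      using that own_attained[of q] p by (cases "\<kappa> q = \<kappa> p") (auto simp: own'_def)
    show "h' i < m" if "i < m" for i using label_less[OF that] p by (simp add: h'_def)
    show "card {q \<in> E. out' q \<noteq> 0 \<and> g q = i} + need' i = ks i" if "i < m" for i
      using count'[OF that] .
    show "h' (g q) \<le> (if own' (\<kappa> q) = 0 then 0 else Suc (h' (g (own' (\<kappa> q) - 1))))"
      if "q \<in> E" "out' q = 0" for q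
      using label'[OF that] by (simp add: key'_def)
  qed
  then show "selection n m g ks E \<kappa> (o1(p := 1)) own' h' (n1(g p := n1 (g p) - 1))"
    by (simp add: out'_def need'_def)
qed

text \<open>Let \<open>V v\<close> be the colours of label at least \<open>v\<close>, together with \<open>a\<close>. These \<open>m + 1\<close> nonempty decreasing
  sets of at most \<open>m\<close> colours cannot all differ, and for \<open>V (Suc v) = V v\<close> all clusters meeting
  \<open>V v\<close> are already owned by colours of \<open>V v\<close>.\<close>

lemma hall_violation:
  assumes a: "a < m" "0 < need a"
    and stuck: "\<And>q. q \<in> E \<Longrightarrow> out q = 0 \<Longrightarrow> g q = a \<Longrightarrow> m \<le> key (\<kappa> q)"
  shows "\<exists>V\<subseteq>{..<m}. card (\<kappa> ` {p \<in> E. g p \<in> V}) < (\<Sum>i\<in>V. ks i)"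
proof -
  define V where "V v = insert a {i. i < m \<and> v \<le> h i}" for v
  have fin: "finite (V v)" for v by (simp add: V_def)
  have anti: "V (Suc v) \<subseteq> V v" for v by (auto simp: V_def)
  have "\<exists>v<m. V (Suc v) = V v"
  proof (rule ccontr)
    assume no: "\<not> ?thesis"
    have "card (V v) + v \<le> m" if "v \<le> m" for v
      using that
    proof (induction v)
      case 0
      have "V 0 = {..<m}" using a by (auto simp: V_def)
      then show ?case by simp
    next
      case (Suc v)
      have "card (V (Suc v)) < card (V v)"
        by (rule psubset_card_mono[OF fin]) (use no Suc.prems anti in auto)
      then show ?case using Suc by simp
    qed
    from this[of m] have "card (V m) = 0" by simp
    then show False using fin by (simp add: V_def)
  qed
  then obtain v where v: "v < m" "V (Suc v) = V v" by blast
  let ?V = "V v"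
  have sub: "?V \<subseteq> {..<m}" using a by (auto simp: V_def)
  have closed: "\<exists>r\<in>E. \<kappa> r = \<kappa> q \<and> out r \<noteq> 0 \<and> g r \<in> ?V" if q: "q \<in> E" "g q \<in> ?V" for q
  proof (cases "out q = 0")
    case True
    \<comment> \<open>Colour \<open>a\<close> satisfies this by \<open>stuck\<close> and
      \<open>v < m\<close>, any other colour because \<open>V (Suc v) = V v\<close> lifts its label
      to \<open>Suc v\<close>. Such a key reveals an owner with label at least \<open>v\<close>,
      whose colour is again in \<open>V v\<close>.\<close>
    have "Suc v \<le> key (\<kappa> q)"
    proof (cases "g q = a")
      case eq: True
      then show ?thesis using stuck[OF q(1) True] v by simp
    next
      case False
      then have "Suc v \<le> h (g q)" using q v(2) by (auto simp: V_def)
      then show ?thesis using label_le[OF q(1) True] by simp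
    qed
    then obtain r where r: "r \<in> E" "\<kappa> r = \<kappa> q" "own (\<kappa> q) = Suc r" "v \<le> h (g r)"
      using own_attained[OF q(1)] by (auto simp: key_def split: if_splits)
    then have "out r \<noteq> 0" using own_out[of r] by simp
    moreover have "g r \<in> ?V" using r colour_less E_less by (auto simp: V_def)
    ultimately show ?thesis using r by blast
  qed (use q in blast)
  have "\<kappa> ` {p \<in> E. g p \<in> ?V} \<subseteq> \<kappa> ` {p \<in> {q \<in> E. out q \<noteq> 0}. g p \<in> ?V}"
    using closed by (fastforce simp: image_iff)
  then have "card (\<kappa> ` {p \<in> E. g p \<in> ?V}) \<le> card (\<kappa> ` {p \<in> {q \<in> E. out q \<noteq> 0}. g p \<in> ?V})"
    by (rule card_mono[rotated]) (use finite_E in auto)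
  also have "\<dots> \<le> card {p \<in> {q \<in> E. out q \<noteq> 0}. g p \<in> ?V}"
    by (rule card_image_le) (use finite_E in auto)
  also have "\<dots> = (\<Sum>i\<in>?V. card {q \<in> {q \<in> E. out q \<noteq> 0}. g q = i})"
    by (rule card_eq_sum_colours) (use finite_E fin in auto)
  \<comment> \<open>No colour has more selected points than it requires, and \<open>a\<close> still
    has a deficit, which makes the sum strict.\<close>
  also have "\<dots> < (\<Sum>i\<in>?V. ks i)"
  proof (rule sum_strict_mono_ex1[OF fin])
    show "\<forall>i\<in>?V. card {q \<in> {q \<in> E. out q \<noteq> 0}. g q = i} \<le> ks i"
      using need_eq sub by (auto simp: conj_assoc) (metis (no_types, lifting) le_add1 lessThan_iff subsetD)
    show "\<exists>i\<in>?V. card {q \<in> {q \<in> E. out q \<noteq> 0}. g q = i} < ks i"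
      using need_eq[OF a(1)] a by (intro bexI[of _ a]) (auto simp: conj_assoc V_def)
  qed
  finally show ?thesis using sub by blast
qed

lemma solution:
  assumes "\<And>i. i < m \<Longrightarrow> need i = 0"
  shows "fair_indices n m g ks {q. q < n \<and> out q \<noteq> 0}"
    and "p < n \<Longrightarrow> q < n \<Longrightarrow> out p \<noteq> 0 \<Longrightarrow> out q \<noteq> 0 \<Longrightarrow> p \<noteq> q \<Longrightarrow> p \<in> E \<and> q \<in> E \<and> \<kappa> p \<noteq> \<kappa> q"
proof -
  have "{q \<in> {q. q < n \<and> out q \<noteq> 0}. g q = i} = {q \<in> E. out q \<noteq> 0 \<and> g q = i}" for i
    using out_E E_less by auto
  then show "fair_indices n m g ks {q. q < n \<and> out q \<noteq> 0}"
    using need_eq assms by (auto simp: fair_indices_def)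
  show "p \<in> E \<and> q \<in> E \<and> \<kappa> p \<noteq> \<kappa> q"
    if "p < n" "q < n" "out p \<noteq> 0" "out q \<noteq> 0" "p \<noteq> q"
    using that out_E[of p] out_E[of q] own_out[of p] own_out[of q] by auto
qed

end

lemma (in clustering) selection_initial:
  assumes "\<And>q. q < n \<Longrightarrow> out q = 0" "\<And>q. q < n \<Longrightarrow> mark q \<noteq> 0 \<Longrightarrow> own (mark q) = 0"
    "\<And>i. i < m \<Longrightarrow> h i = 0" "\<And>i. i < m \<Longrightarrow> need i = ks i"
  shows "selection n m g ks E mark out own h need"
proof
  show "q < n" if "q \<in> E" for q using E_less that .
  show "g q < m" if "q < n" for q using colour_less that .
  show "p = q" if "p \<in> E" "q \<in> E" "mark p = mark q" "g p = g q" for p q using rainbow that .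
  show "card {q \<in> E. out q \<noteq> 0 \<and> g q = i} + need i = ks i" if "i < m" for i
  proof -
    have "{q \<in> E. out q \<noteq> 0 \<and> g q = i} = {}" using assms(1) E_less by auto
    then show ?thesis using assms(4)[OF that] by (simp only: card.empty)
  qed
qed (use assms E_less mark_chosen colour_less in \<open>auto intro: le_less_trans\<close>)

text \<open>The invariant \<open>far\<close> points only from an earlier cluster to a later one;
  comparing marks and symmetry of the distance cover both orders.\<close>

lemma (in clustering) separated_solution:
  assumes "M \<subseteq> {..<n}" "\<And>p q. p \<in> M \<Longrightarrow> q \<in> M \<Longrightarrow> p \<noteq> q \<Longrightarrow> p \<in> E \<and> q \<in> E \<and> mark p \<noteq> mark q"
  shows "separated \<delta> \<tau> M"
  unfolding separated_def
proof (intro ballI impI)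
  fix p q assume pq: "p \<in> M" "q \<in> M" "p \<noteq> q"
  then have "p \<in> E" "q \<in> E" "mark p \<noteq> mark q" using assms by blast+
  then show "\<tau> \<le> \<delta> p q"
    using far[of p q] far[of q p] dist_sym[of p q] E_less by (cases "mark p < mark q") auto
qed

section \<open>Time-bounded program logic\<close>

text \<open>A weakest precondition with a time budget: the postcondition also receives the unused budget.\<close>

definition wp :: "(nat \<Rightarrow> nat \<Rightarrow> real) \<Rightarrow> com \<Rightarrow> (state \<Rightarrow> nat \<Rightarrow> bool) \<Rightarrow> state \<Rightarrow> nat \<Rightarrow> bool" where
  "wp \<delta> P Q s B \<longleftrightarrow> (\<exists>t s'. exec \<delta> P s t s' \<and> t \<le> B \<and> Q s' (B - t))"

text \<open>Used for loops and program phases, where an upper bound on time is enough;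
  \<open>wp\<close> handles straight-line code, whose costs the simplifier computes exactly.\<close>

definition runs :: "(nat \<Rightarrow> nat \<Rightarrow> real) \<Rightarrow> com \<Rightarrow> state \<Rightarrow> nat \<Rightarrow> (state \<Rightarrow> bool) \<Rightarrow> bool" where
  "runs \<delta> P s T Q \<longleftrightarrow> wp \<delta> P (\<lambda>s' _. Q s') s T"

lemma runs_iff: "runs \<delta> P s T Q \<longleftrightarrow> (\<exists>t s'. exec \<delta> P s t s' \<and> t \<le> T \<and> Q s')"
  by (simp add: runs_def wp_def)

lemma wp_deterministic:
  assumes "\<And>t s'. exec \<delta> P s t s' \<longleftrightarrow> t = t0 \<and> s' = s0"
  shows "wp \<delta> P Q s B \<longleftrightarrow> t0 \<le> B \<and> Q s0 (B - t0)"
  by (simp add: wp_def assms)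

lemma wp_Skip: "wp \<delta> Skip Q s B \<longleftrightarrow> 1 \<le> B \<and> Q s (B - 1)"
  by (rule wp_deterministic) (use exec.Skip[of \<delta> s] in \<open>auto elim: exec_SkipE\<close>)

lemma wp_NAssign: "wp \<delta> (NAssign x a) Q s B \<longleftrightarrow> 1 + ncost a \<le> B \<and>
    Q (s\<lparr>nvar := (nvar s)(x := nval a s)\<rparr>) (B - (1 + ncost a))"
  by (rule wp_deterministic) (use exec.NAssign[of \<delta> x a s] in \<open>auto elim: exec_NAssignE\<close>)

lemma wp_NStore: "wp \<delta> (NStore x i a) Q s B \<longleftrightarrow> 1 + ncost i + ncost a \<le> B \<and>
    Q (s\<lparr>narr := (narr s)(x := (narr s x)(nval i s := nval a s))\<rparr>) (B - (1 + ncost i + ncost a))"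
  by (rule wp_deterministic) (use exec.NStore[of \<delta> x i a s] in \<open>auto elim: exec_NStoreE\<close>)

lemma wp_RAssign: "wp \<delta> (RAssign x a) Q s B \<longleftrightarrow> 1 + rcost a \<le> B \<and>
    Q (s\<lparr>rvar := (rvar s)(x := rval \<delta> a s)\<rparr>) (B - (1 + rcost a))"
  by (rule wp_deterministic) (use exec.RAssign[of \<delta> x a s] in \<open>auto elim: exec_RAssignE\<close>)

lemma wp_Seq: "wp \<delta> (Seq P1 P2) Q s B \<longleftrightarrow> wp \<delta> P1 (\<lambda>s' B'. wp \<delta> P2 Q s' B') s B"
proof
  assume "wp \<delta> (Seq P1 P2) Q s B"
  then obtain t s' where "exec \<delta> (Seq P1 P2) s t s'" "t \<le> B" "Q s' (B - t)" by (auto simp: wp_def)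
  then show "wp \<delta> P1 (\<lambda>s' B'. wp \<delta> P2 Q s' B') s B"
    by (elim exec_SeqE) (fastforce simp: wp_def)
next
  assume "wp \<delta> P1 (\<lambda>s' B'. wp \<delta> P2 Q s' B') s B"
  then obtain t1 s1 t2 s2 where e: "exec \<delta> P1 s t1 s1" "exec \<delta> P2 s1 t2 s2"
    "t1 \<le> B" "t2 \<le> B - t1" "Q s2 (B - t1 - t2)" by (auto simp: wp_def)
  then show "wp \<delta> (Seq P1 P2) Q s B"
    using exec.Seq[OF e(1,2)] by (force simp: wp_def)
qed

lemma wp_Cond: "wp \<delta> (Cond b P1 P2) Q s B \<longleftrightarrow> 1 + bcost b \<le> B \<and>
    (if bval \<delta> b s then wp \<delta> P1 Q s (B - (1 + bcost b)) else wp \<delta> P2 Q s (B - (1 + bcost b)))"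
  (is "?l \<longleftrightarrow> ?r")
proof
  assume ?l
  then obtain t s' where "exec \<delta> (Cond b P1 P2) s t s'" "t \<le> B" "Q s' (B - t)" by (auto simp: wp_def)
  then show ?r
    by (elim exec_CondE) (fastforce simp: wp_def)+
next
  assume r: ?r
  then obtain t s' where e: "t \<le> B - (1 + bcost b)" "Q s' (B - (1 + bcost b) - t)"
    "bval \<delta> b s \<and> exec \<delta> P1 s t s' \<or> \<not> bval \<delta> b s \<and> exec \<delta> P2 s t s'"
    by (auto simp: wp_def split: if_splits)
  then have "exec \<delta> (Cond b P1 P2) s (1 + bcost b + t) s'"
    using exec.CondTrue[of \<delta> b s P1] exec.CondFalse[of \<delta> b s P2] by blast
  then show ?l using e r by (force simp: wp_def)
qed

lemmas wp_simps = wp_Skip wp_NAssign wp_NStore wp_RAssign wp_Seq wp_Cond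

lemma runs_mono: "runs \<delta> P s T Q \<Longrightarrow> T \<le> T' \<Longrightarrow> (\<And>s'. Q s' \<Longrightarrow> Q' s') \<Longrightarrow> runs \<delta> P s T' Q'"
  by (fastforce simp: runs_iff)

lemma runs_Seq: "runs \<delta> P1 s T1 R \<Longrightarrow> (\<And>s'. R s' \<Longrightarrow> runs \<delta> P2 s' T2 Q) \<Longrightarrow> runs \<delta> (Seq P1 P2) s (T1 + T2) Q"
  unfolding runs_iff by (meson add_le_mono exec.Seq)

text \<open>The variant \<open>v\<close> bounds the remaining rounds and may drop by more than one,
  hence strong induction. The summand outside the product pays for the final failing test.\<close>

lemma runs_Loop:
  assumes I: "I v s"
    and body: "\<And>v s. I v s \<Longrightarrow> bval \<delta> b s \<Longrightarrow> 0 < v \<and> runs \<delta> P s T (\<lambda>s'. \<exists>w<v. I w s')"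
    and exit: "\<And>v s. I v s \<Longrightarrow> \<not> bval \<delta> b s \<Longrightarrow> Q s"
  shows "runs \<delta> (Loop b P) s ((1 + bcost b) + v * (1 + bcost b + T)) Q"
  using I
proof (induction v arbitrary: s rule: less_induct)
  case (less v)
  show ?case
  proof (cases "bval \<delta> b s")
    case True
    then obtain t s' w where s': "exec \<delta> P s t s'" "t \<le> T" "w < v" "I w s'"
      using body[OF less.prems] by (auto simp: runs_iff)
    then obtain u s'' where s'': "exec \<delta> (Loop b P) s' u s''" "Q s''"
      "u \<le> (1 + bcost b) + w * (1 + bcost b + T)"
      using less.IH[of w s'] by (auto simp: runs_iff)
    have "exec \<delta> (Loop b P) s (1 + bcost b + t + u) s''" using exec.LoopTrue True s' s'' by blast
    moreover have "Suc w * (1 + bcost b + T) \<le> v * (1 + bcost b + T)"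
      by (rule mult_le_mono1) (use s' in simp)
    ultimately show ?thesis using s' s'' by (fastforce simp: runs_iff)
  next
    case False
    then have "exec \<delta> (Loop b P) s (1 + bcost b) s" by (rule exec.LoopFalse)
    then show ?thesis using exit[OF less.prems False] by (fastforce simp: runs_iff)
  qed
qed

definition For :: "string \<Rightarrow> string \<Rightarrow> com \<Rightarrow> com" where
  "For x y P = Seq (NAssign x (NLit 0))
     (Loop (NLess (NVar x) (NVar y)) (Seq P (NAssign x (NAdd (NVar x) (NLit 1)))))"

text \<open>The 6 is the initial assignment (2) plus the last test (4); the 8 is one test (4) plus
  one increment (4). The body must establish the invariant for the state with the counter already
  advanced.\<close>

lemma runs_For:
  assumes start: "I 0 (s\<lparr>nvar := (nvar s)(x := 0)\<rparr>)"
    and bound: "\<And>j s. I j s \<Longrightarrow> nvar s x = j \<and> nvar s y = N"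
    and body: "\<And>j s. I j s \<Longrightarrow> j < N \<Longrightarrow>
      runs \<delta> P s T (\<lambda>s'. nvar s' x = j \<and> I (Suc j) (s'\<lparr>nvar := (nvar s')(x := Suc j)\<rparr>))"
  shows "runs \<delta> (For x y P) s (6 + N * (8 + T)) (I N)"
proof -
  let ?L = "Loop (NLess (NVar x) (NVar y)) (Seq P (NAssign x (NAdd (NVar x) (NLit 1))))"
  let ?J = "\<lambda>v s. I (N - v) s \<and> v \<le> N"
  have "runs \<delta> ?L (s\<lparr>nvar := (nvar s)(x := 0)\<rparr>) ((1 + bcost (NLess (NVar x) (NVar y))) +
      N * (1 + bcost (NLess (NVar x) (NVar y)) + (T + 4))) (I N)"
  proof (rule runs_Loop[where I = ?J])
    fix v s assume J: "?J v s" and b: "bval \<delta> (NLess (NVar x) (NVar y)) s"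
    have v: "0 < v" using bound[of "N - v" s] J b by auto
    have "runs \<delta> (Seq P (NAssign x (NAdd (NVar x) (NLit 1)))) s (T + 4) (\<lambda>s'. ?J (v - 1) s')"
    proof (rule runs_Seq)
      show "runs \<delta> P s T (\<lambda>s'. nvar s' x = N - v \<and> I (Suc (N - v)) (s'\<lparr>nvar := (nvar s')(x := Suc (N - v))\<rparr>))"
        by (rule body) (use J v in auto)
      show "runs \<delta> (NAssign x (NAdd (NVar x) (NLit 1))) s' 4 (\<lambda>s'. ?J (v - 1) s')"
        if "nvar s' x = N - v \<and> I (Suc (N - v)) (s'\<lparr>nvar := (nvar s')(x := Suc (N - v))\<rparr>)" for s'
      proof -
        have "N - (v - 1) = Suc (N - v)" "v - 1 \<le> N" using J v by auto
        then show ?thesis using that by (simp add: runs_def wp_simps)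
      qed
    qed
    then show "0 < v \<and> runs \<delta> (Seq P (NAssign x (NAdd (NVar x) (NLit 1)))) s (T + 4) (\<lambda>s'. \<exists>w<v. ?J w s')"
      using v by (auto elim!: runs_mono intro: exI[of _ "v - 1"])
  next
    fix v s assume J: "?J v s" and b: "\<not> bval \<delta> (NLess (NVar x) (NVar y)) s"
    then have "v = 0" using bound[of "N - v" s] by auto
    then show "I N s" using J by simp
  qed (use start in simp)
  then have "runs \<delta> ?L (s\<lparr>nvar := (nvar s)(x := 0)\<rparr>) (4 + N * (8 + T)) (I N)"
    by (rule runs_mono) (auto simp: algebra_simps)
  then have "runs \<delta> (For x y P) s (2 + (4 + N * (8 + T))) (I N)"
    unfolding For_def
    by (intro runs_Seq[where R = "\<lambda>s'. s' = s\<lparr>nvar := (nvar s)(x := 0)\<rparr>"])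
      (auto simp: runs_def wp_simps)
  then show ?thesis by simp
qed

section \<open>The program\<close>

abbreviation sequence (infixr ";;" 60) where "P ;; Q \<equiv> Seq P Q"

definition reset_points :: com where
  "reset_points = For ''i'' ''n''
     (NStore ''mark'' (NVar ''i'') (NLit 0) ;; NStore ''ch'' (NVar ''i'') (NLit 0) ;;
      NStore ''out'' (NVar ''i'') (NLit 0))"

definition reset_colours :: com where
  "reset_colours = For ''i'' ''m''
     (NStore ''cnt'' (NVar ''i'') (NLit 0) ;; NStore ''last'' (NVar ''i'') (NLit 0) ;;
      NStore ''h'' (NVar ''i'') (NLit 0) ;; NStore ''need'' (NVar ''i'') (NCell ''count'' (NVar ''i'')))"

text \<open>One scan collects both kinds of candidates: \<open>a\<close> extends the current
  cluster, \<open>b\<close> can open a new one. Both hold an index plus 1, with 0 meaning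
  none.\<close>

definition find_point :: com where
  "find_point = NAssign ''a'' (NLit 0) ;; NAssign ''b'' (NLit 0) ;;
     For ''i'' ''n''
       (Cond (NLess (NCell ''cnt'' (NCell ''group'' (NVar ''i''))) (NVar ''k''))
         (Cond (BAnd (NEq (NCell ''mark'' (NVar ''i'')) (NVar ''c''))
                     (NLess (NCell ''last'' (NCell ''group'' (NVar ''i''))) (NVar ''c'')))
            (NAssign ''a'' (NAdd (NVar ''i'') (NLit 1))) Skip ;;
          Cond (NEq (NCell ''mark'' (NVar ''i'')) (NLit 0))
            (NAssign ''b'' (NAdd (NVar ''i'') (NLit 1))) Skip)
         Skip)"

text \<open>The entry of \<open>own\<close> is cleared when its cluster opens, so values left from
  earlier thresholds do no harm. The counter \<open>c\<close> advances even if no candidate exists;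
  the last cluster then counts as closed.\<close>

definition open_cluster :: com where
  "open_cluster = Cond (NEq (NVar ''a'') (NLit 0))
     (NAssign ''a'' (NVar ''b'') ;; NAssign ''c'' (NAdd (NVar ''c'') (NLit 1)) ;;
      NStore ''own'' (NVar ''c'') (NLit 0))
     Skip"

abbreviation "point_a \<equiv> NSub (NVar ''a'') (NLit 1)"

definition mark_ball :: com where
  "mark_ball = For ''i'' ''n''
     (Cond (BAnd (NEq (NCell ''mark'' (NVar ''i'')) (NLit 0)) (RLess (Dist point_a (NVar ''i'')) (RVar ''t'')))
        (NStore ''mark'' (NVar ''i'') (NVar ''c'')) Skip)"

definition choose_point :: com where
  "choose_point =
     NStore ''ch'' point_a (NLit 1) ;;
     NStore ''cnt'' (NCell ''group'' point_a) (NAdd (NCell ''cnt'' (NCell ''group'' point_a)) (NLit 1)) ;;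
     NStore ''last'' (NCell ''group'' point_a) (NVar ''c'')"

text \<open>With \<open>c = 0\<close> no \<open>last\<close> entry is below \<open>c\<close>, so the
  first scan finds no extension and cluster 1 is opened. The initial \<open>a = 1\<close> merely
  enters the loop.\<close>

definition build_clusters :: com where
  "build_clusters = NAssign ''c'' (NLit 0) ;; NAssign ''a'' (NLit 1) ;;
     Loop (NLess (NLit 0) (NVar ''a''))
       (find_point ;; open_cluster ;; Cond (NLess (NLit 0) (NVar ''a'')) (choose_point ;; mark_ball) Skip)"

definition find_colour :: com where
  "find_colour = NAssign ''a'' (NLit 0) ;;
     For ''i'' ''m'' (Cond (NLess (NLit 0) (NCell ''need'' (NVar ''i'')))
       (NAssign ''a'' (NAdd (NVar ''i'') (NLit 1))) Skip)"

abbreviation "owner_i \<equiv> NCell ''own'' (NCell ''mark'' (NVar ''i''))"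

text \<open>Starting \<open>e\<close> at \<open>m\<close> rejects keys of \<open>m\<close> or more:
  taking such a cluster would give a label outside the range \<open>label_less\<close>, and their
  exclusive presence is the hypothesis \<open>stuck\<close> of
  \<open>hall_violation\<close>.\<close>

definition find_edge :: com where
  "find_edge = NAssign ''b'' (NLit 0) ;; NAssign ''e'' (NVar ''m'') ;;
     For ''i'' ''n''
       (Cond (BAnd (NLess (NLit 0) (NCell ''ch'' (NVar ''i''))) (BAnd (NEq (NCell ''out'' (NVar ''i'')) (NLit 0))
                (NEq (NAdd (NCell ''group'' (NVar ''i'')) (NLit 1)) (NVar ''a''))))
         (Cond (NEq owner_i (NLit 0)) (NAssign ''x'' (NLit 0))
            (NAssign ''x'' (NAdd (NCell ''h'' (NCell ''group'' (NSub owner_i (NLit 1)))) (NLit 1))) ;;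
          Cond (NLess (NVar ''x'') (NVar ''e''))
            (NAssign ''e'' (NVar ''x'') ;; NAssign ''b'' (NAdd (NVar ''i'') (NLit 1))) Skip)
         Skip)"

abbreviation "point_b \<equiv> NSub (NVar ''b'') (NLit 1)"
abbreviation "point_o \<equiv> NSub (NVar ''o'') (NLit 1)"

text \<open>During selection \<open>a\<close> holds a colour plus 1, so \<open>point_a\<close>
  denotes a colour here. The old owner is saved in \<open>o\<close> before \<open>own\<close> is
  overwritten.\<close>

definition take_edge :: com where
  "take_edge =
     NAssign ''o'' (NCell ''own'' (NCell ''mark'' point_b)) ;;
     Cond (NEq (NVar ''o'') (NLit 0)) Skip
       (NStore ''out'' point_o (NLit 0) ;;
        NStore ''need'' (NCell ''group'' point_o) (NAdd (NCell ''need'' (NCell ''group'' point_o)) (NLit 1))) ;;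
     NStore ''own'' (NCell ''mark'' point_b) (NVar ''b'') ;;
     NStore ''out'' point_b (NLit 1) ;;
     NStore ''h'' point_a (NVar ''e'') ;;
     NStore ''need'' point_a (NSub (NCell ''need'' point_a) (NLit 1))"

text \<open>\<open>b = 0\<close> ends the loop in two ways: with \<open>f = 1\<close> when no colour
  is in need, and with \<open>f\<close> still 0 when a needy colour has no admissible
  cluster.\<close>

definition select_points :: com where
  "select_points = NAssign ''b'' (NLit 1) ;;
     Loop (NLess (NLit 0) (NVar ''b''))
       (find_colour ;;
        Cond (NEq (NVar ''a'') (NLit 0))
          (NAssign ''f'' (NLit 1) ;; NAssign ''b'' (NLit 0))
          (find_edge ;; Cond (NLess (NLit 0) (NVar ''b'')) take_edge Skip))"

definition attempt :: com where
  "attempt = reset_points ;; reset_colours ;; build_clusters ;; select_points"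

definition sum_counts :: com where
  "sum_counts = For ''i'' ''m''
     (NAssign ''k'' (NAdd (NVar ''k'') (NCell ''count'' (NVar ''i''))))"

definition initial_threshold :: com where
  "initial_threshold =
     For ''i'' ''n''
       (Cond (RLess (RVar ''t'') (Dist (NLit 0) (NVar ''i''))) (RAssign ''t'' (Dist (NLit 0) (NVar ''i''))) Skip) ;;
     RAssign ''t'' (RDiv (RAdd (RVar ''t'') (RVar ''t'')) (OfNat (NAdd (NVar ''m'') (NLit 1))))"

definition fair_program :: com where
  "fair_program = sum_counts ;; initial_threshold ;;
     Loop (NEq (NVar ''f'') (NLit 0))
       (attempt ;; RAssign ''t'' (RDiv (RVar ''t'') (RAdd (OfNat (NLit 1)) (RVar ''eps''))))"

section \<open>Specifications and running times of the individual scans\<close>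

definition found :: "nat \<Rightarrow> (nat \<Rightarrow> bool) \<Rightarrow> nat \<Rightarrow> bool" where
  "found j P v \<longleftrightarrow> v = 0 \<and> (\<forall>q<j. \<not> P q) \<or> (\<exists>q<j. P q \<and> v = Suc q)"

lemma found_0 [simp]: "found 0 P v \<longleftrightarrow> v = 0"
  by (simp add: found_def)

lemma found_Suc: "found j P v \<Longrightarrow> found (Suc j) P (if P j then Suc j else v)"
  by (auto simp: found_def less_Suc_eq)

definition best :: "nat \<Rightarrow> (nat \<Rightarrow> bool) \<Rightarrow> (nat \<Rightarrow> nat) \<Rightarrow> nat \<Rightarrow> nat \<Rightarrow> nat \<Rightarrow> bool" where
  "best j P K u v e \<longleftrightarrow> v = 0 \<and> e = u \<and> (\<forall>q<j. P q \<longrightarrow> u \<le> K q) \<or>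
     (\<exists>p<j. P p \<and> v = Suc p \<and> e = K p \<and> K p < u \<and> (\<forall>q<j. P q \<longrightarrow> K p \<le> K q))"

lemma best_0 [simp]: "best 0 P K u v e \<longleftrightarrow> v = 0 \<and> e = u"
  by (simp add: best_def)

lemma best_Suc:
  assumes "best j P K u v e"
  shows "best (Suc j) P K u (if P j \<and> K j < e then Suc j else v) (if P j \<and> K j < e then K j else e)"
proof (cases "P j \<and> K j < e")
  case True
  then have "K j < u" "\<forall>q<j. P q \<longrightarrow> K j \<le> K q" using assms by (force simp: best_def)+
  then show ?thesis using True by (auto simp: best_def less_Suc_eq)
next
  case False
  then show ?thesis using assms by (auto simp: best_def less_Suc_eq not_less)
qed

definition frame :: "string set \<Rightarrow> string set \<Rightarrow> state \<Rightarrow> state \<Rightarrow> bool" where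
  "frame V W s s' \<longleftrightarrow> rvar s' = rvar s \<and> (\<forall>x. x \<notin> V \<longrightarrow> nvar s' x = nvar s x) \<and>
     (\<forall>x. x \<notin> W \<longrightarrow> narr s' x = narr s x)"

lemma frame_refl [simp]: "frame V W s s"
  by (simp add: frame_def)

lemma frame_nvar_update [simp]:
  "x \<in> V \<Longrightarrow> frame V W s (s'\<lparr>nvar := f(x := v)\<rparr>) \<longleftrightarrow> frame V W s (s'\<lparr>nvar := f\<rparr>)"
  by (auto simp: frame_def)

lemma frame_nvar_same [simp]: "frame V W s (s'\<lparr>nvar := nvar s'\<rparr>) \<longleftrightarrow> frame V W s s'"
  by (simp add: frame_def)

lemma frameD:
  assumes "frame V W s s'"
  shows "rvar s' = rvar s" "x \<notin> V \<Longrightarrow> nvar s' x = nvar s x" "x \<notin> W \<Longrightarrow> narr s' x = narr s x"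
  using assms by (auto simp: frame_def)

lemma runs_NAssign:
  "runs \<delta> P (s\<lparr>nvar := (nvar s)(x := nval a s)\<rparr>) T Q \<Longrightarrow> runs \<delta> (NAssign x a ;; P) s (1 + ncost a + T) Q"
  by (auto simp: runs_def wp_simps)

text \<open>As in the other scans, the factor of \<open>n\<close> is the loop overhead 8 plus a
  generous budget for one body, here 52.\<close>

lemma runs_find_point:
  assumes n: "nvar s ''n'' = n"
  shows "runs \<delta> find_point s (10 + n * 60) (\<lambda>s'. frame {''a'', ''b'', ''i''} {} s s' \<and>
    found n (\<lambda>q. narr s ''cnt'' (narr s ''group'' q) < nvar s ''k'' \<and> narr s ''mark'' q = nvar s ''c'' \<and>
      narr s ''last'' (narr s ''group'' q) < nvar s ''c'') (nvar s' ''a'') \<and>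
    found n (\<lambda>q. narr s ''cnt'' (narr s ''group'' q) < nvar s ''k'' \<and> narr s ''mark'' q = 0) (nvar s' ''b''))"
    (is "runs _ _ _ _ (\<lambda>s'. ?F s' \<and> found n ?A _ \<and> found n ?B _)")
proof -
  let ?I = "\<lambda>j s'. nvar s' ''i'' = j \<and> ?F s' \<and> found j ?A (nvar s' ''a'') \<and> found j ?B (nvar s' ''b'')"
  have "runs \<delta> find_point s (1 + ncost (NLit 0) + (1 + ncost (NLit 0) + (6 + n * (8 + 52)))) (?I n)"
    unfolding find_point_def
  proof (intro runs_NAssign, rule runs_For[where I = ?I], goal_cases)
    case (2 j s')
    then show ?case using frameD(2)[OF 2[THEN conjunct2, THEN conjunct1], of "''n''"] n by simp
  next
    case (3 j s')
    note fr = frameD[OF 3(1)[THEN conjunct2, THEN conjunct1]]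
    have "found (Suc j) ?A (if ?A j then Suc j else nvar s' ''a'')"
      "found (Suc j) ?B (if ?B j then Suc j else nvar s' ''b'')"
      "nvar s' ''i'' = j" "?F s'"
      using 3 found_Suc by blast+
    then show ?case
      using fr(2)[of "''k''"] fr(2)[of "''c''"] fr(3) by (auto simp: runs_def wp_simps split: if_splits)
  qed simp
  then show ?thesis by (rule runs_mono) auto
qed

lemma runs_find_colour:
  assumes m: "nvar s ''m'' = m"
  shows "runs \<delta> find_colour s (8 + m * 20) (\<lambda>s'. frame {''a'', ''i''} {} s s' \<and>
    found m (\<lambda>q. 0 < narr s ''need'' q) (nvar s' ''a''))"
    (is "runs _ _ _ _ (\<lambda>s'. ?F s' \<and> found m ?A _)")
proof -
  let ?I = "\<lambda>j s'. nvar s' ''i'' = j \<and> ?F s' \<and> found j ?A (nvar s' ''a'')"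
  have "runs \<delta> find_colour s (1 + ncost (NLit 0) + (6 + m * (8 + 12))) (?I m)"
    unfolding find_colour_def
  proof (intro runs_NAssign, rule runs_For[where I = ?I], goal_cases)
    case (2 j s')
    then show ?case using frameD(2)[OF 2[THEN conjunct2, THEN conjunct1], of "''m''"] m by simp
  next
    case (3 j s')
    note fr = frameD[OF 3(1)[THEN conjunct2, THEN conjunct1]]
    have "found (Suc j) ?A (if ?A j then Suc j else nvar s' ''a'')" "nvar s' ''i'' = j" "?F s'"
      using 3 found_Suc by blast+
    then show ?case
      using fr(3) by (auto simp: runs_def wp_simps split: if_splits)
  qed simp
  then show ?thesis by (rule runs_mono) auto
qed

definition cluster_key :: "state \<Rightarrow> nat \<Rightarrow> nat" where
  "cluster_key s v = (if narr s ''own'' v = 0 then 0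
     else Suc (narr s ''h'' (narr s ''group'' (narr s ''own'' v - 1))))"

lemma runs_find_edge:
  assumes n: "nvar s ''n'' = n"
  shows "runs \<delta> find_edge s (10 + n * 70) (\<lambda>s'. frame {''b'', ''e'', ''i'', ''x''} {} s s' \<and>
    best n (\<lambda>q. 0 < narr s ''ch'' q \<and> narr s ''out'' q = 0 \<and> Suc (narr s ''group'' q) = nvar s ''a'')
      (\<lambda>q. cluster_key s (narr s ''mark'' q)) (nvar s ''m'') (nvar s' ''b'') (nvar s' ''e''))"
    (is "runs _ _ _ _ (\<lambda>s'. ?F s' \<and> best n ?P ?K ?u _ _)")
proof -
  let ?I = "\<lambda>j s'. nvar s' ''i'' = j \<and> ?F s' \<and> best j ?P ?K ?u (nvar s' ''b'') (nvar s' ''e'')"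
  have "runs \<delta> find_edge s (1 + ncost (NLit 0) + (1 + ncost (NVar ''m'') + (6 + n * (8 + 62)))) (?I n)"
    unfolding find_edge_def
  proof (intro runs_NAssign, rule runs_For[where I = ?I], goal_cases)
    case (2 j s')
    then show ?case using frameD(2)[OF 2[THEN conjunct2, THEN conjunct1], of "''n''"] n by simp
  next
    case (3 j s')
    note fr = frameD[OF 3(1)[THEN conjunct2, THEN conjunct1]]
    have "best (Suc j) ?P ?K ?u (if ?P j \<and> ?K j < nvar s' ''e'' then Suc j else nvar s' ''b'')
        (if ?P j \<and> ?K j < nvar s' ''e'' then ?K j else nvar s' ''e'')"
      "nvar s' ''i'' = j" "?F s'"
      using 3 best_Suc by blast+
    moreover have "?K j = (if narr s ''own'' (narr s ''mark'' j) = 0 then 0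
     else Suc (narr s ''h'' (narr s ''group'' (narr s ''own'' (narr s ''mark'' j) - 1))))"
      by (simp add: cluster_key_def)
    ultimately show ?case
      using fr(2)[of "''a''"] fr(3)
      by (cases "narr s ''own'' (narr s ''mark'' j) = 0") (auto simp: runs_def wp_simps split: if_splits)
  qed simp
  then show ?thesis by (rule runs_mono) auto
qed

lemma runs_mark_ball:
  assumes n: "nvar s ''n'' = n"
  shows "runs \<delta> mark_ball s (6 + n * 40) (\<lambda>s'. s' = s\<lparr>nvar := (nvar s)(''i'' := n),
    narr := (narr s)(''mark'' := \<lambda>q. if q < n \<and> narr s ''mark'' q = 0 \<and> \<delta> (nvar s ''a'' - 1) q < rvar s ''t''
      then nvar s ''c'' else narr s ''mark'' q)\<rparr>)"
    (is "runs _ _ _ _ (\<lambda>s'. s' = ?S n)")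
proof -
  let ?M = "\<lambda>j q. if q < j \<and> narr s ''mark'' q = 0 \<and> \<delta> (nvar s ''a'' - 1) q < rvar s ''t''
      then nvar s ''c'' else narr s ''mark'' q"
  let ?I = "\<lambda>j s'. s' = s\<lparr>nvar := (nvar s)(''i'' := j), narr := (narr s)(''mark'' := ?M j)\<rparr>"
  have "runs \<delta> mark_ball s (6 + n * (8 + 32)) (?I n)"
    unfolding mark_ball_def
  proof (rule runs_For[where I = ?I], goal_cases)
    case 1
    show ?case by simp
  next
    case (2 j s')
    then show ?case using n by simp
  next
    case (3 j s')
    \<comment> \<open>The test in round \<open>j\<close> reads only the mark of \<open>j\<close>
      itself, so marking in place agrees with marking the whole ball at once.\<close>
    have "?M (Suc j) = (if narr s ''mark'' j = 0 \<and> \<delta> (nvar s ''a'' - 1) j < rvar s ''t''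
      then (?M j)(j := nvar s ''c'') else ?M j)"
      by (auto simp: fun_eq_iff less_Suc_eq)
    then show ?case using 3 by (auto simp: runs_def wp_simps)
  qed
  then show ?thesis by (rule runs_mono) auto
qed

lemma runs_reset_points:
  assumes n: "nvar s ''n'' = n"
  shows "runs \<delta> reset_points s (6 + n * 20) (\<lambda>s'. frame {''i''} {''mark'', ''ch'', ''out''} s s' \<and>
    (\<forall>q<n. narr s' ''mark'' q = 0 \<and> narr s' ''ch'' q = 0 \<and> narr s' ''out'' q = 0))"
    (is "runs _ _ _ _ (\<lambda>s'. ?F s' \<and> ?Z n s')")
proof -
  let ?I = "\<lambda>j s'. nvar s' ''i'' = j \<and> ?F s' \<and> ?Z j s'"
  have "runs \<delta> reset_points s (6 + n * (8 + 12)) (?I n)"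
    unfolding reset_points_def
  proof (rule runs_For[where I = ?I], goal_cases)
    case (2 j s')
    then show ?case using frameD(2)[OF 2[THEN conjunct2, THEN conjunct1], of "''n''"] n by simp
  next
    case (3 j s')
    then show ?case by (auto simp: runs_def wp_simps frame_def less_Suc_eq)
  qed simp
  then show ?thesis by (rule runs_mono) auto
qed

lemma runs_reset_colours:
  assumes m: "nvar s ''m'' = m"
  shows "runs \<delta> reset_colours s (6 + m * 30) (\<lambda>s'. frame {''i''} {''cnt'', ''last'', ''h'', ''need''} s s' \<and>
    (\<forall>i<m. narr s' ''cnt'' i = 0 \<and> narr s' ''last'' i = 0 \<and> narr s' ''h'' i = 0 \<and>
      narr s' ''need'' i = narr s ''count'' i))"
    (is "runs _ _ _ _ (\<lambda>s'. ?F s' \<and> ?Z m s')")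
proof -
  let ?I = "\<lambda>j s'. nvar s' ''i'' = j \<and> ?F s' \<and> ?Z j s'"
  have "runs \<delta> reset_colours s (6 + m * (8 + 22)) (?I m)"
    unfolding reset_colours_def
  proof (rule runs_For[where I = ?I], goal_cases)
    case (2 j s')
    then show ?case using frameD(2)[OF 2[THEN conjunct2, THEN conjunct1], of "''m''"] m by simp
  next
    case (3 j s')
    then show ?case by (auto simp: runs_def wp_simps frame_def less_Suc_eq)
  qed simp
  then show ?thesis by (rule runs_mono) auto
qed

lemma runs_sum_counts:
  assumes m: "nvar s ''m'' = m" and k: "nvar s ''k'' = 0"
  shows "runs \<delta> sum_counts s (6 + m * 20) (\<lambda>s'. frame {''i'', ''k''} {} s s' \<and>
    nvar s' ''k'' = (\<Sum>i<m. narr s ''count'' i))"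
    (is "runs _ _ _ _ (\<lambda>s'. ?F s' \<and> ?Z m s')")
proof -
  let ?I = "\<lambda>j s'. nvar s' ''i'' = j \<and> ?F s' \<and> ?Z j s'"
  have "runs \<delta> sum_counts s (6 + m * (8 + 12)) (?I m)"
    unfolding sum_counts_def
  proof (rule runs_For[where I = ?I], goal_cases)
    case (2 j s')
    then show ?case using frameD(2)[OF 2[THEN conjunct2, THEN conjunct1], of "''m''"] m by simp
  next
    case (3 j s')
    note fr = frameD[OF 3(1)[THEN conjunct2, THEN conjunct1]]
    show ?case using 3 fr(3)[of "''count''"] by (simp add: runs_def wp_simps)
  qed (simp add: k)
  then show ?thesis by (rule runs_mono) auto
qed

text \<open>The alternative \<open>r = 0\<close> is the start value of the scan and makes the
  invariant true of the empty prefix.\<close>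

definition radius :: "(nat \<Rightarrow> nat \<Rightarrow> real) \<Rightarrow> nat \<Rightarrow> real \<Rightarrow> bool" where
  "radius \<delta> n r \<longleftrightarrow> (\<forall>q<n. \<delta> 0 q \<le> r) \<and> (r = 0 \<or> (\<exists>q<n. r = \<delta> 0 q))"

lemma runs_initial_threshold:
  assumes n: "nvar s ''n'' = n" and t: "rvar s ''t'' = 0"
  shows "runs \<delta> initial_threshold s (30 + n * 25) (\<lambda>s'. \<exists>r. radius \<delta> n r \<and>
    s' = s\<lparr>nvar := (nvar s)(''i'' := n), rvar := (rvar s)(''t'' := 2 * r / (real (nvar s ''m'') + 1))\<rparr>)"
proof -
  let ?I = "\<lambda>j s'. \<exists>r. radius \<delta> j r \<and> s' = s\<lparr>nvar := (nvar s)(''i'' := j), rvar := (rvar s)(''t'' := r)\<rparr>"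
  have step: "radius \<delta> (Suc j) (if r < \<delta> 0 j then \<delta> 0 j else r)" if "radius \<delta> j r" for j r
    using that by (fastforce simp: radius_def less_Suc_eq not_less)
  have "runs \<delta> initial_threshold s ((6 + n * (8 + 17)) + 24) (\<lambda>s'. \<exists>r. radius \<delta> n r \<and>
    s' = s\<lparr>nvar := (nvar s)(''i'' := n), rvar := (rvar s)(''t'' := 2 * r / (real (nvar s ''m'') + 1))\<rparr>)"
    unfolding initial_threshold_def
  proof (rule runs_Seq)
    show "runs \<delta> (For ''i'' ''n''
       (Cond (RLess (RVar ''t'') (Dist (NLit 0) (NVar ''i''))) (RAssign ''t'' (Dist (NLit 0) (NVar ''i''))) Skip))
       s (6 + n * (8 + 17)) (?I n)"
    proof (rule runs_For[where I = ?I], goal_cases)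
      case 1
      have "(rvar s)(''t'' := 0) = rvar s" using t by (auto simp: fun_eq_iff)
      then show ?case by (intro exI[of _ 0]) (simp add: radius_def)
    next
      case (2 j s')
      then show ?case using n by auto
    next
      case (3 j s')
      then obtain r where "radius \<delta> j r"
        "s' = s\<lparr>nvar := (nvar s)(''i'' := j), rvar := (rvar s)(''t'' := r)\<rparr>" by blast
      then show ?case using step[of j r] by (auto simp: runs_def wp_simps split: if_splits)
    qed
  next
    fix s' assume "?I n s'"
    then show "runs \<delta> (RAssign ''t'' (RDiv (RAdd (RVar ''t'') (RVar ''t'')) (OfNat (NAdd (NVar ''m'') (NLit 1))))) s' 24
      (\<lambda>s'. \<exists>r. radius \<delta> n r \<and>
        s' = s\<lparr>nvar := (nvar s)(''i'' := n), rvar := (rvar s)(''t'' := 2 * r / (real (nvar s ''m'') + 1))\<rparr>)"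
      by (auto simp: runs_def wp_simps add.commute)
  qed
  then show ?thesis by (rule runs_mono) auto
qed

section \<open>Verification of the clustering\<close>

lemma frame_narr: "frame V {} s s' \<Longrightarrow> narr s' = narr s"
  by (auto simp: frame_def fun_eq_iff)

locale indexed_run = indexed_instance +
  fixes \<epsilon> :: real
  assumes accuracy_pos: "0 < \<epsilon>"
begin

definition env :: "real \<Rightarrow> state \<Rightarrow> bool" where
  "env \<tau> s \<longleftrightarrow> nvar s ''n'' = n \<and> nvar s ''m'' = m \<and> nvar s ''k'' = k \<and>
     narr s ''group'' = g \<and> narr s ''count'' = ks \<and> rvar s ''t'' = \<tau> \<and> rvar s ''eps'' = \<epsilon>"

definition chosen :: "state \<Rightarrow> nat set" where
  "chosen s = {q. q < n \<and> narr s ''ch'' q \<noteq> 0}"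

definition clustered :: "real \<Rightarrow> state \<Rightarrow> bool" where
  "clustered \<tau> s \<longleftrightarrow> env \<tau> s \<and>
     clustering n m k g ks \<delta> \<tau> (narr s ''mark'') (narr s ''ch'') (narr s ''cnt'') (narr s ''last'') (nvar s ''c'')"

definition unselected :: "state \<Rightarrow> bool" where
  "unselected s \<longleftrightarrow> nvar s ''f'' = 0 \<and> (\<forall>q<n. narr s ''out'' q = 0) \<and>
     (\<forall>i<m. narr s ''h'' i = 0 \<and> narr s ''need'' i = ks i) \<and>
     (\<forall>v. v \<noteq> 0 \<longrightarrow> v \<le> nvar s ''c'' \<longrightarrow> narr s ''own'' v = 0)"

definition exhausted :: "state \<Rightarrow> bool" where
  "exhausted s \<longleftrightarrow> (\<forall>q<n. narr s ''cnt'' (g q) < k \<longrightarrow>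
     narr s ''mark'' q \<noteq> 0 \<and> narr s ''mark'' q \<noteq> nvar s ''c'')"

definition extendable :: "nat \<Rightarrow> state \<Rightarrow> bool" where
  "extendable p s \<longleftrightarrow> p < n \<and> narr s ''cnt'' (g p) < k \<and> narr s ''last'' (g p) < nvar s ''c'' \<and>
     (narr s ''mark'' p = nvar s ''c'' \<or>
      narr s ''mark'' p = 0 \<and> (\<forall>q\<in>chosen s. narr s ''mark'' q \<noteq> nvar s ''c''))"

lemma env_frame:
  assumes "env \<tau> s" "frame V W s s'" "''n'' \<notin> V" "''m'' \<notin> V" "''k'' \<notin> V" "''group'' \<notin> W" "''count'' \<notin> W"
  shows "env \<tau> s'"
  using assms by (simp add: env_def frameD[OF assms(2)])

lemma clustered_frame:
  assumes "clustered \<tau> s" "frame V {} s s'" "''n'' \<notin> V" "''m'' \<notin> V" "''k'' \<notin> V" "''c'' \<notin> V"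
  shows "clustered \<tau> s'"
  using assms env_frame[OF _ assms(2)] by (simp add: clustered_def frameD[OF assms(2)] frame_narr[OF assms(2)])

lemma unselected_frame:
  assumes "unselected s" "frame V {} s s'" "''f'' \<notin> V" "''c'' \<notin> V"
  shows "unselected s'"
  using assms by (simp add: unselected_def frameD[OF assms(2)] frame_narr[OF assms(2)])

lemma chosen_cong: "narr s' ''ch'' = narr s ''ch'' \<Longrightarrow> chosen s' = chosen s"
  by (simp add: chosen_def)

lemma runs_open_cluster:
  assumes cl: "clustered \<tau> s" and un: "unselected s"
    and a: "found n (\<lambda>q. narr s ''cnt'' (g q) < k \<and> narr s ''mark'' q = nvar s ''c'' \<and>
      narr s ''last'' (g q) < nvar s ''c'') (nvar s ''a'')"
    and b: "found n (\<lambda>q. narr s ''cnt'' (g q) < k \<and> narr s ''mark'' q = 0) (nvar s ''b'')"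
  shows "runs \<delta> open_cluster s 20 (\<lambda>s'. clustered \<tau> s' \<and> unselected s' \<and> chosen s' = chosen s \<and>
    (if nvar s' ''a'' = 0 then exhausted s' else \<exists>p. nvar s' ''a'' = Suc p \<and> extendable p s'))"
proof (cases "nvar s ''a'' = 0")
  case False
  then obtain p where "p < n" "narr s ''cnt'' (g p) < k" "narr s ''mark'' p = nvar s ''c''"
      "narr s ''last'' (g p) < nvar s ''c''" "nvar s ''a'' = Suc p"
    using a by (auto simp: found_def)
  then show ?thesis
    using cl un by (auto simp: runs_def wp_simps open_cluster_def extendable_def)
next
  case True
  interpret clustering n m k g ks \<delta> \<tau> "narr s ''mark''" "narr s ''ch''" "narr s ''cnt''" "narr s ''last''" "nvar s ''c''" "chosen s"
    using cl by (simp_all add: clustered_def chosen_def)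
  have next': "clustering n m k g ks \<delta> \<tau> (narr s ''mark'') (narr s ''ch'') (narr s ''cnt'') (narr s ''last'') (Suc (nvar s ''c''))"
    by (rule next_cluster) (use a True in \<open>auto simp: found_def not_less\<close>)
  let ?s = "s\<lparr>nvar := (nvar s)(''a'' := nvar s ''b'', ''c'' := Suc (nvar s ''c'')),
      narr := (narr s)(''own'' := (narr s ''own'')(Suc (nvar s ''c'') := 0))\<rparr>"
  have "clustered \<tau> ?s" using cl next' by (simp add: clustered_def env_def)
  moreover have "unselected ?s" using un by (auto simp: unselected_def le_Suc_eq)
  moreover have "chosen ?s = chosen s" by (rule chosen_cong) simp
  \<comment> \<open>Without a candidate every point of a live colour is covered, and its mark is at
    most the old counter, hence different from the new one.\<close>
  moreover have "exhausted ?s" if b0: "nvar s ''b'' = 0"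
    using b b0 mark_le by (fastforce simp: found_def exhausted_def)
  moreover have "\<exists>p. nvar s ''b'' = Suc p \<and> extendable p ?s" if b1: "nvar s ''b'' \<noteq> 0"
  proof -
    obtain p where p: "p < n" "narr s ''cnt'' (g p) < k" "narr s ''mark'' p = 0" "nvar s ''b'' = Suc p"
      using b1 b by (auto simp: found_def)
    have "narr s ''last'' (g p) < Suc (nvar s ''c'')"
      using last_le[OF colour_less[OF p(1)]] by simp
    moreover have "\<forall>q\<in>chosen s. narr s ''mark'' q \<noteq> Suc (nvar s ''c'')"
      using mark_le by (fastforce simp: chosen_def)
    ultimately have "extendable p ?s"
      using p \<open>chosen ?s = chosen s\<close> by (simp add: extendable_def)
    then show ?thesis using p by blast
  qed
  moreover have "runs \<delta> open_cluster s 20 (\<lambda>s'. s' = ?s)"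
    using True by (simp add: runs_def wp_simps open_cluster_def)
  ultimately show ?thesis by (elim runs_mono) auto
qed

lemma runs_choose_point:
  assumes cl: "clustered \<tau> s" and un: "unselected s" and a: "nvar s ''a'' = Suc p" and p: "extendable p s"
  shows "runs \<delta> (choose_point ;; mark_ball) s (56 + n * 40) (\<lambda>s'. clustered \<tau> s' \<and> unselected s' \<and>
    nvar s' ''a'' \<noteq> 0 \<and> card (chosen s') = Suc (card (chosen s)))"
proof -
  interpret clustering n m k g ks \<delta> \<tau> "narr s ''mark''" "narr s ''ch''" "narr s ''cnt''" "narr s ''last''" "nvar s ''c''" "chosen s"
    using cl by (simp_all add: clustered_def chosen_def)
  have env: "env \<tau> s" using cl by (simp add: clustered_def)
  let ?M = "\<lambda>q. if q < n \<and> narr s ''mark'' q = 0 \<and> \<delta> p q < \<tau> then nvar s ''c'' else narr s ''mark'' q"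
  let ?t = "s\<lparr>narr := (narr s)(''ch'' := (narr s ''ch'')(p := 1),
      ''cnt'' := (narr s ''cnt'')(g p := Suc (narr s ''cnt'' (g p))),
      ''last'' := (narr s ''last'')(g p := nvar s ''c''))\<rparr>"
  let ?s = "s\<lparr>nvar := (nvar s)(''i'' := n), narr := (narr s)(''ch'' := (narr s ''ch'')(p := 1),
      ''cnt'' := (narr s ''cnt'')(g p := Suc (narr s ''cnt'' (g p))),
      ''last'' := (narr s ''last'')(g p := nvar s ''c''), ''mark'' := ?M)\<rparr>"
  have p': "p < n" "narr s ''cnt'' (g p) < k" "narr s ''last'' (g p) < nvar s ''c''"
    "narr s ''mark'' p = nvar s ''c'' \<or>
     narr s ''mark'' p = 0 \<and> (\<forall>q\<in>chosen s. narr s ''mark'' q \<noteq> nvar s ''c'')"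
    using p by (auto simp: extendable_def)
  have "clustered \<tau> ?s" using env add_point(1)[OF p'] by (simp add: clustered_def env_def)
  moreover have "unselected ?s" using un by (simp add: unselected_def)
  moreover have "chosen ?s = insert p (chosen s)" "p \<notin> chosen s"
    using add_point(2,3)[OF p'] by (simp_all add: chosen_def)
  moreover have "finite (chosen s)" by (simp add: chosen_def)
  moreover have "runs \<delta> (choose_point ;; mark_ball) s (50 + (6 + n * 40)) (\<lambda>s'. s' = ?s)"
  proof (rule runs_Seq)
    show "runs \<delta> choose_point s 50 (\<lambda>s'. s' = ?t)"
      using env a by (simp add: runs_def wp_simps choose_point_def env_def)
    show "runs \<delta> mark_ball s' (6 + n * 40) (\<lambda>s'. s' = ?s)" if s': "s' = ?t" for s'
    proof -
      have "nvar ?t ''n'' = n" using env by (simp add: env_def)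
      from runs_mark_ball[OF this, of \<delta>] show ?thesis
        unfolding s' by (rule runs_mono) (use env a in \<open>simp_all add: env_def cong: if_cong\<close>)
    qed
  qed
  ultimately show ?thesis using a by (elim runs_mono) auto
qed

lemma runs_build_clusters:
  assumes s: "env \<tau> s" "0 < \<tau>" "nvar s ''f'' = 0"
    and points: "\<And>q. q < n \<Longrightarrow> narr s ''mark'' q = 0 \<and> narr s ''ch'' q = 0 \<and> narr s ''out'' q = 0"
    and colours: "\<And>i. i < m \<Longrightarrow> narr s ''cnt'' i = 0 \<and> narr s ''last'' i = 0 \<and> narr s ''h'' i = 0 \<and>
      narr s ''need'' i = ks i"
  shows "runs \<delta> build_clusters s (8 + Suc (k * m) * (100 + n * 100))
    (\<lambda>s'. clustered \<tau> s' \<and> unselected s' \<and> exhausted s')"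
proof -
  let ?s = "s\<lparr>nvar := (nvar s)(''c'' := 0, ''a'' := 1)\<rparr>"
  \<comment> \<open>The variant is \<open>Suc (k * m)\<close> minus the number of chosen points; the
    successor leaves room for the final scan, which adds nothing.\<close>
  let ?I = "\<lambda>v s. clustered \<tau> s \<and> unselected s \<and>
    (if nvar s ''a'' = 0 then exhausted s else v + card (chosen s) = Suc (k * m))"
  let ?F = "find_point ;; open_cluster ;; Cond (NLess (NLit 0) (NVar ''a'')) (choose_point ;; mark_ball) Skip"
  let ?Q = "\<lambda>s s'. clustered \<tau> s' \<and> unselected s' \<and>
    (if nvar s' ''a'' = 0 then exhausted s' else card (chosen s') = Suc (card (chosen s)))"
  have body: "runs \<delta> ?F s (96 + n * 100) (?Q s)"
    if cl: "clustered \<tau> s" and un: "unselected s" for s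
  proof -
    have env: "env \<tau> s" using cl by (simp add: clustered_def)
    then have "nvar s ''n'' = n" by (simp add: env_def)
    note find = runs_find_point[OF this, of \<delta>]
    have "runs \<delta> ?F s ((10 + n * 60) + (20 + (66 + n * 40))) (?Q s)"
    proof (rule runs_Seq[OF find], elim conjE)
      fix s1 assume fr: "frame {''a'', ''b'', ''i''} {} s s1"
        and ab: "found n (\<lambda>q. narr s ''cnt'' (narr s ''group'' q) < nvar s ''k'' \<and> narr s ''mark'' q = nvar s ''c'' \<and>
          narr s ''last'' (narr s ''group'' q) < nvar s ''c'') (nvar s1 ''a'')"
          "found n (\<lambda>q. narr s ''cnt'' (narr s ''group'' q) < nvar s ''k'' \<and> narr s ''mark'' q = 0) (nvar s1 ''b'')"
      have cl1: "clustered \<tau> s1" "unselected s1"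
        using clustered_frame[OF cl fr] unselected_frame[OF un fr] by simp_all
      have ch1: "chosen s1 = chosen s" using frame_narr[OF fr] by (intro chosen_cong) simp
      have "runs \<delta> open_cluster s1 20 (\<lambda>s'. clustered \<tau> s' \<and> unselected s' \<and> chosen s' = chosen s1 \<and>
        (if nvar s' ''a'' = 0 then exhausted s' else \<exists>p. nvar s' ''a'' = Suc p \<and> extendable p s'))"
        by (rule runs_open_cluster[OF cl1])
          (use ab env in \<open>simp_all add: frame_narr[OF fr] frameD(2)[OF fr] env_def\<close>)
      then show "runs \<delta> (open_cluster ;; Cond (NLess (NLit 0) (NVar ''a'')) (choose_point ;; mark_ball) Skip) s1
          (20 + (66 + n * 40)) (?Q s)"
      proof (rule runs_Seq, elim conjE)
        fix s2 assume s2: "clustered \<tau> s2" "unselected s2" "chosen s2 = chosen s1"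
          "if nvar s2 ''a'' = 0 then exhausted s2 else \<exists>p. nvar s2 ''a'' = Suc p \<and> extendable p s2"
        show "runs \<delta> (Cond (NLess (NLit 0) (NVar ''a'')) (choose_point ;; mark_ball) Skip) s2 (66 + n * 40) (?Q s)"
        proof (cases "nvar s2 ''a'' = 0")
          case True
          then show ?thesis using s2 by (simp add: runs_def wp_simps)
        next
          case False
          then obtain p where p: "nvar s2 ''a'' = Suc p" "extendable p s2" using s2 by auto
          have "runs \<delta> (choose_point ;; mark_ball) s2 (62 + n * 40) (?Q s)"
            using runs_choose_point[OF s2(1,2) p] by (rule runs_mono) (use s2 ch1 in auto)
          then show ?thesis using False by (simp add: runs_def wp_Cond)
        qed
      qed
    qed
    then show ?thesis by (rule runs_mono) auto
  qed
  have "runs \<delta> (Loop (NLess (NLit 0) (NVar ''a'')) ?F) ?s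
      ((1 + bcost (NLess (NLit 0) (NVar ''a''))) +
        Suc (k * m) * (1 + bcost (NLess (NLit 0) (NVar ''a'')) + (96 + n * 100)))
      (\<lambda>s'. clustered \<tau> s' \<and> unselected s' \<and> exhausted s')"
  proof (rule runs_Loop[where I = ?I])
    have "clustering n m k g ks \<delta> \<tau> (narr s ''mark'') (narr s ''ch'') (narr s ''cnt'') (narr s ''last'') 0"
      by (rule clustering_initial) (use points colours s in auto)
    then have "clustered \<tau> ?s" using s by (simp add: clustered_def env_def)
    moreover have "unselected ?s" using points colours s by (simp add: unselected_def)
    moreover have "chosen ?s = {}" using points by (auto simp: chosen_def)
    ultimately show "?I (Suc (k * m)) ?s" by simp
  next
    fix v s assume I: "?I v s" and "bval \<delta> (NLess (NLit 0) (NVar ''a'')) s"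
    then have a: "nvar s ''a'' \<noteq> 0" by simp
    have le: "card (chosen s) \<le> k * m" if "clustered \<tau> s" for s
      using clustering.card_E_le[of n m k g ks \<delta> \<tau> "narr s ''mark''" "narr s ''ch''" "narr s ''cnt''" "narr s ''last''" "nvar s ''c''"]
        that by (simp add: clustered_def chosen_def)
    have v: "0 < v" "v + card (chosen s) = Suc (k * m)" using I a le[of s] by auto
    have "runs \<delta> ?F s (96 + n * 100) (?Q s)" using body I by blast
    then have "runs \<delta> ?F s (96 + n * 100) (\<lambda>s'. ?I (v - 1) s')"
      by (rule runs_mono) (use v in auto)
    then show "0 < v \<and> runs \<delta> ?F s (96 + n * 100) (\<lambda>s'. \<exists>w<v. ?I w s')"
      using v by (auto elim!: runs_mono intro: exI[of _ "v - 1"])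
  qed auto
  then have "runs \<delta> (Loop (NLess (NLit 0) (NVar ''a'')) ?F) ?s (4 + Suc (k * m) * (100 + n * 100))
      (\<lambda>s'. clustered \<tau> s' \<and> unselected s' \<and> exhausted s')"
    by (rule runs_mono) auto
  then have "runs \<delta> build_clusters s (1 + ncost (NLit 0) + (1 + ncost (NLit 1) + (4 + Suc (k * m) * (100 + n * 100))))
      (\<lambda>s'. clustered \<tau> s' \<and> unselected s' \<and> exhausted s')"
    unfolding build_clusters_def by (intro runs_NAssign) simp
  then show ?thesis by (rule runs_mono) auto
qed

end

section \<open>Verification of the matching\<close>

context indexed_run
begin

definition matched :: "real \<Rightarrow> state \<Rightarrow> bool" where
  "matched \<tau> s \<longleftrightarrow> clustered \<tau> s \<and> exhausted s \<and>
     selection n m g ks (chosen s) (narr s ''mark'') (narr s ''out'') (narr s ''own'') (narr s ''h'') (narr s ''need'')"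

definition potential :: "state \<Rightarrow> nat" where
  "potential s = (\<Sum>v\<in>narr s ''mark'' ` chosen s. cluster_key s v)"

text \<open>The certificate of an attempt. The gap of \<open>m + 1\<close> between the two
  thresholds is the approximation loss; nothing is claimed about which outcome occurs in
  between.\<close>

definition concluded :: "real \<Rightarrow> state \<Rightarrow> bool" where
  "concluded \<tau> s \<longleftrightarrow> env \<tau> s \<and>
     (if nvar s ''f'' = 0 then \<forall>M. fair_indices n m g ks M \<longrightarrow> \<not> separated \<delta> ((real m + 1) * \<tau>) M
      else fair_indices n m g ks {q. q < n \<and> narr s ''out'' q \<noteq> 0} \<and>
        separated \<delta> \<tau> {q. q < n \<and> narr s ''out'' q \<noteq> 0})"

text \<open>A meta-equality because \<open>key\<close> is a defined parameter of
  \<open>selection\<close> and interpreting the locale asks for its defining equation.\<close>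

lemma cluster_key_eq:
  assumes "env \<tau> s"
  shows "cluster_key s \<equiv> \<lambda>v. if narr s ''own'' v = 0 then 0 else Suc (narr s ''h'' (g (narr s ''own'' v - 1)))"
  by (rule eq_reflection) (use assms in \<open>simp add: env_def cluster_key_def fun_eq_iff\<close>)

lemma matched_frame:
  assumes "matched \<tau> s" "frame V {} s s'" "''n'' \<notin> V" "''m'' \<notin> V" "''k'' \<notin> V" "''c'' \<notin> V"
  shows "matched \<tau> s'"
  using assms clustered_frame[OF _ assms(2)] chosen_cong[of s' s]
  by (simp add: matched_def exhausted_def frameD[OF assms(2)] frame_narr[OF assms(2)])

lemma potential_frame: "frame V {} s s' \<Longrightarrow> potential s' = potential s"
  using chosen_cong[of s' s] frame_narr[of V s s']
  by (simp add: potential_def cluster_key_def cong: if_cong)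

lemma potential_le:
  assumes "matched \<tau> s"
  shows "potential s \<le> m * (k * m)"
proof -
  interpret clustering n m k g ks \<delta> \<tau> "narr s ''mark''" "narr s ''ch''" "narr s ''cnt''" "narr s ''last''" "nvar s ''c''" "chosen s"
    using assms by (simp_all add: matched_def clustered_def chosen_def)
  have g: "narr s ''group'' = g" using assms by (simp add: matched_def clustered_def env_def)
  have "potential s \<le> m * card (chosen s)"
    using selection.key_sum_le[of n m g ks "chosen s" "narr s ''mark''" "narr s ''out''" "narr s ''own''" "narr s ''h''" "narr s ''need''"] assms
    by (simp add: matched_def potential_def cluster_key_def g cong: if_cong)
  also have "\<dots> \<le> m * (k * m)" using card_E_le by simp
  finally show ?thesis .
qed

lemma runs_take_edge:
  assumes s: "matched \<tau> s" and a: "nvar s ''a'' = Suc (g p)" "0 < narr s ''need'' (g p)"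
    and b: "nvar s ''b'' = Suc p" and p: "p \<in> chosen s" "narr s ''out'' p = 0"
    and e: "nvar s ''e'' = cluster_key s (narr s ''mark'' p)" "cluster_key s (narr s ''mark'' p) < m"
    and cheapest: "\<And>q. q \<in> chosen s \<Longrightarrow> narr s ''out'' q = 0 \<Longrightarrow> g q = g p \<Longrightarrow>
      cluster_key s (narr s ''mark'' p) \<le> cluster_key s (narr s ''mark'' q)"
  shows "runs \<delta> take_edge s 100 (\<lambda>s'. matched \<tau> s' \<and> potential s < potential s' \<and>
    nvar s' ''b'' \<noteq> 0 \<and> nvar s' ''f'' = nvar s ''f'')"
proof -
  have env: "env \<tau> s" using s by (simp add: matched_def clustered_def)
  interpret selection n m g ks "chosen s" "narr s ''mark''" "narr s ''out''" "narr s ''own''" "narr s ''h''" "narr s ''need''" "cluster_key s"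
    by (use s in \<open>simp add: matched_def\<close>) (rule cluster_key_eq[OF env])
  have g: "narr s ''group'' = g" using env by (simp add: env_def)
  let ?v = "narr s ''mark'' p" and ?own = "narr s ''own''" and ?need = "narr s ''need''"
  let ?o = "if ?own ?v = 0 then narr s ''out'' else (narr s ''out'')(?own ?v - 1 := 0)"
  let ?n = "if ?own ?v = 0 then ?need
      else ?need(g (?own ?v - 1) := Suc (?need (g (?own ?v - 1))))"
  let ?own' = "?own(?v := Suc p)" and ?h' = "(narr s ''h'')(g p := cluster_key s ?v)"
  let ?P = "\<lambda>s'. frame {''o''} {''own'', ''out'', ''h'', ''need''} s s' \<and> narr s' ''own'' = ?own' \<and>
    narr s' ''out'' = ?o(p := 1) \<and> narr s' ''h'' = ?h' \<and> narr s' ''need'' = ?n(g p := ?n (g p) - 1)"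
  note step = take_cluster[OF p a(2) e(2) cheapest]
  have "matched \<tau> s' \<and> potential s < potential s' \<and> nvar s' ''b'' \<noteq> 0 \<and> nvar s' ''f'' = nvar s ''f''"
    if P: "?P s'" for s'
  proof -
    have fr: "frame {''o''} {''own'', ''out'', ''h'', ''need''} s s'" using P by blast
    note simps = frameD[OF fr]
    have ch: "chosen s' = chosen s" by (rule chosen_cong) (simp add: simps)
    have "clustered \<tau> s'" using s env_frame[OF env fr] by (simp add: matched_def clustered_def simps)
    moreover have "exhausted s'" using s by (simp add: matched_def exhausted_def simps)
    moreover have mk: "narr s' ''mark'' = narr s ''mark''" by (simp add: simps)
    have eqs: "narr s' ''own'' = ?own'" "narr s' ''out'' = ?o(p := 1)" "narr s' ''h'' = ?h'"
      "narr s' ''need'' = ?n(g p := ?n (g p) - 1)" using P by blast+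
    have "selection n m g ks (chosen s') (narr s' ''mark'') (narr s' ''out'') (narr s' ''own'') (narr s' ''h'') (narr s' ''need'')"
      unfolding eqs ch mk by (rule step(1))
    ultimately have "matched \<tau> s'" by (simp add: matched_def)
    moreover have "potential s < potential s'"
    proof -
      have "env \<tau> s'" using env_frame[OF env fr] by simp
      note key' = cluster_key_eq[OF this]
      show ?thesis unfolding potential_def key' eqs ch mk by (rule step(2))
    qed
    ultimately show ?thesis using b by (simp add: simps)
  qed
  moreover have "runs \<delta> take_edge s 100 ?P"
    by (cases "?own ?v = 0") (simp_all add: runs_def wp_simps take_edge_def frame_def a b e g)
  ultimately show ?thesis by (elim runs_mono) auto
qed

lemma runs_select_points:
  assumes s: "matched \<tau> s" "nvar s ''f'' = 0"
  shows "runs \<delta> select_points s (6 + Suc (m * (k * m)) * (160 + m * 20 + n * 70)) (concluded \<tau>)"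
proof -
  let ?s = "s\<lparr>nvar := (nvar s)(''b'' := 1)\<rparr>"
  let ?F = "find_colour ;;
        Cond (NEq (NVar ''a'') (NLit 0))
          (NAssign ''f'' (NLit 1) ;; NAssign ''b'' (NLit 0))
          (find_edge ;; Cond (NLess (NLit 0) (NVar ''b'')) take_edge Skip)"
  \<comment> \<open>The potential never exceeds \<open>m * (k * m)\<close>, so the strict inequality
    forces \<open>v\<close> to be positive. An inequality is kept because one takeover may raise the
    potential by more than one.\<close>
  let ?I = "\<lambda>v s. if nvar s ''b'' = 0 then concluded \<tau> s
    else matched \<tau> s \<and> nvar s ''f'' = 0 \<and> m * (k * m) < v + potential s"
  let ?Q = "\<lambda>s s'. if nvar s' ''b'' = 0 then concluded \<tau> s'
    else matched \<tau> s' \<and> nvar s' ''f'' = 0 \<and> potential s < potential s'"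
  have body: "runs \<delta> ?F s (156 + m * 20 + n * 70) (?Q s)" if s: "matched \<tau> s" "nvar s ''f'' = 0" for s
  proof -
    have env: "env \<tau> s" using s by (simp add: matched_def clustered_def)
    then have "nvar s ''m'' = m" by (simp add: env_def)
    note find = runs_find_colour[OF this, of \<delta>]
    have "runs \<delta> ?F s ((8 + m * 20) + (148 + n * 70)) (?Q s)"
    proof (rule runs_Seq[OF find], elim conjE)
      fix s1 assume fr1: "frame {''a'', ''i''} {} s s1" and a: "found m (\<lambda>q. 0 < narr s ''need'' q) (nvar s1 ''a'')"
      note nv1 = frameD(2)[OF fr1] and na1 = frame_narr[OF fr1]
      have s1: "matched \<tau> s1" using matched_frame[OF s(1) fr1] by simp
      have env1: "env \<tau> s1" using s1 by (simp add: matched_def clustered_def)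
      then have g: "narr s1 ''group'' = g" and m1: "nvar s1 ''m'' = m" and n1: "nvar s1 ''n'' = n"
        by (simp_all add: env_def)
      interpret cl: clustering n m k g ks \<delta> \<tau> "narr s1 ''mark''" "narr s1 ''ch''" "narr s1 ''cnt''" "narr s1 ''last''" "nvar s1 ''c''" "chosen s1"
        using s1 by (simp_all add: matched_def clustered_def chosen_def)
      interpret sel: selection n m g ks "chosen s1" "narr s1 ''mark''" "narr s1 ''out''" "narr s1 ''own''" "narr s1 ''h''" "narr s1 ''need''" "cluster_key s1"
        by (use s1 in \<open>simp add: matched_def\<close>) (rule cluster_key_eq[OF env1])
      show "runs \<delta> (Cond (NEq (NVar ''a'') (NLit 0))
          (NAssign ''f'' (NLit 1) ;; NAssign ''b'' (NLit 0))
          (find_edge ;; Cond (NLess (NLit 0) (NVar ''b'')) take_edge Skip)) s1 (148 + n * 70) (?Q s)"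
      proof (cases "nvar s1 ''a'' = 0")
        case True
        then have need0: "narr s1 ''need'' i = 0" if "i < m" for i
          using a that by (simp add: found_def na1)
        let ?M = "{q. q < n \<and> narr s1 ''out'' q \<noteq> 0}"
        have "fair_indices n m g ks ?M" by (rule sel.solution(1)) (rule need0)
        moreover have "separated \<delta> \<tau> ?M"
          by (rule cl.separated_solution) (use sel.solution(2)[OF need0] in auto)
        ultimately have "concluded \<tau> (s1\<lparr>nvar := (nvar s1)(''f'' := 1, ''b'' := 0)\<rparr>)"
          using env1 by (simp add: concluded_def env_def)
        then show ?thesis using True by (simp add: runs_def wp_simps)
      next
        case False
        then obtain i where i: "i < m" "0 < narr s1 ''need'' i" "nvar s1 ''a'' = Suc i"
          using a by (auto simp: found_def na1)
        have "runs \<delta> (find_edge ;; Cond (NLess (NLit 0) (NVar ''b'')) take_edge Skip) s1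
            ((10 + n * 70) + 110) (?Q s)"
        proof (rule runs_Seq[OF runs_find_edge[OF n1]], elim conjE)
          fix s2 assume fr2: "frame {''b'', ''e'', ''i'', ''x''} {} s1 s2"
            and best: "best n (\<lambda>q. 0 < narr s1 ''ch'' q \<and> narr s1 ''out'' q = 0 \<and> Suc (narr s1 ''group'' q) = nvar s1 ''a'')
              (\<lambda>q. cluster_key s1 (narr s1 ''mark'' q)) (nvar s1 ''m'') (nvar s2 ''b'') (nvar s2 ''e'')"
          note nv2 = frameD(2)[OF fr2] and na2 = frame_narr[OF fr2]
          have s2: "matched \<tau> s2" using matched_frame[OF s1 fr2] by simp
          have ch2: "chosen s2 = chosen s1" by (rule chosen_cong) (simp add: na2)
          have key2: "cluster_key s2 = cluster_key s1" by (simp add: cluster_key_def na2 fun_eq_iff)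
          have f2: "nvar s2 ''f'' = 0" using s by (simp add: nv1 nv2)
          have pot: "potential s2 = potential s" using potential_frame[OF fr1] potential_frame[OF fr2] by simp
          show "runs \<delta> (Cond (NLess (NLit 0) (NVar ''b'')) take_edge Skip) s2 110 (?Q s)"
          proof (cases "nvar s2 ''b'' = 0")
            case True
            have "m \<le> cluster_key s1 (narr s1 ''mark'' q)"
              if "q \<in> chosen s1" "narr s1 ''out'' q = 0" "g q = i" for q
              using best that True i by (auto simp: best_def chosen_def g m1)
            then obtain V where V: "V \<subseteq> {..<m}"
              "card (narr s1 ''mark'' ` {p \<in> chosen s1. g p \<in> V}) < (\<Sum>i\<in>V. ks i)"
              using sel.hall_violation[OF i(1,2)] by blast
            have ex: "narr s1 ''mark'' q \<noteq> 0 \<and> narr s1 ''mark'' q \<noteq> nvar s1 ''c''"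
              if "q < n" "narr s1 ''cnt'' (g q) < k" for q
              using s1 that by (simp add: matched_def exhausted_def)
            \<comment> \<open>A well separated fair set would give Hall's condition for the very set
              \<open>V\<close> that violates it.\<close>
            have "\<not> separated \<delta> ((real m + 1) * \<tau>) M" if "fair_indices n m g ks M" for M
              using cl.hall[OF ex that _ V(1)] V(2) by fastforce
            then have "concluded \<tau> s2"
              using s2 f2 by (simp add: concluded_def matched_def clustered_def)
            then show ?thesis using True by (simp add: runs_def wp_simps)
          next
            case False
            then obtain p where p: "p < n" "0 < narr s1 ''ch'' p" "narr s1 ''out'' p = 0" "g p = i"
              "nvar s2 ''b'' = Suc p" "nvar s2 ''e'' = cluster_key s1 (narr s1 ''mark'' p)"
              "cluster_key s1 (narr s1 ''mark'' p) < m"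
              "\<And>q. q < n \<Longrightarrow> 0 < narr s1 ''ch'' q \<Longrightarrow> narr s1 ''out'' q = 0 \<Longrightarrow> g q = i \<Longrightarrow>
                cluster_key s1 (narr s1 ''mark'' p) \<le> cluster_key s1 (narr s1 ''mark'' q)"
              using best i by (auto simp: best_def g m1)
            have "runs \<delta> take_edge s2 100 (\<lambda>s'. matched \<tau> s' \<and> potential s2 < potential s' \<and>
              nvar s' ''b'' \<noteq> 0 \<and> nvar s' ''f'' = nvar s2 ''f'')"
              by (rule runs_take_edge[OF s2, of p])
                (use p i in \<open>auto simp: nv2 na2 ch2 key2 chosen_def\<close>)
            then have "runs \<delta> take_edge s2 106 (?Q s)" by (rule runs_mono) (use f2 pot in auto)
            then show ?thesis using False by (simp add: runs_def wp_Cond)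
          qed
        qed
        then have "runs \<delta> (find_edge ;; Cond (NLess (NLit 0) (NVar ''b'')) take_edge Skip) s1
            (144 + n * 70) (?Q s)" by (rule runs_mono) auto
        then show ?thesis using False by (simp add: runs_def wp_Cond)
      qed
    qed
    then show ?thesis by (rule runs_mono) auto
  qed
  have "runs \<delta> (Loop (NLess (NLit 0) (NVar ''b'')) ?F) ?s
      ((1 + bcost (NLess (NLit 0) (NVar ''b''))) +
        Suc (m * (k * m)) * (1 + bcost (NLess (NLit 0) (NVar ''b'')) + (156 + m * 20 + n * 70)))
      (concluded \<tau>)"
  proof (rule runs_Loop[where I = ?I])
    have "frame {''b''} {} s ?s" by simp
    then have "matched \<tau> ?s" using matched_frame[OF s(1)] by fastforce
    then show "?I (Suc (m * (k * m))) ?s" using s by simp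
  next
    fix v s assume I: "?I v s" and "bval \<delta> (NLess (NLit 0) (NVar ''b'')) s"
    then have a: "nvar s ''b'' \<noteq> 0" by simp
    have v: "0 < v" using I a potential_le[of \<tau> s] by auto
    have "runs \<delta> ?F s (156 + m * 20 + n * 70) (?Q s)" using body[of s] I a by simp
    then have "runs \<delta> ?F s (156 + m * 20 + n * 70) (\<lambda>s'. ?I (v - 1) s')"
      by (rule runs_mono) (use v I a in \<open>auto split: if_splits\<close>)
    then show "0 < v \<and> runs \<delta> ?F s (156 + m * 20 + n * 70) (\<lambda>s'. \<exists>w<v. ?I w s')"
      using v by (auto elim!: runs_mono intro: exI[of _ "v - 1"])
  qed auto
  then have "runs \<delta> select_points s (1 + ncost (NLit 1) + ((1 + bcost (NLess (NLit 0) (NVar ''b''))) +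
        Suc (m * (k * m)) * (1 + bcost (NLess (NLit 0) (NVar ''b'')) + (156 + m * 20 + n * 70)))) (concluded \<tau>)"
    unfolding select_points_def by (intro runs_NAssign) simp
  then show ?thesis by (rule runs_mono) auto
qed

text \<open>\<open>max 1 k\<close> keeps the bound positive for \<open>k = 0\<close>, when the
  arrays are still scanned.\<close>

definition attempt_time :: nat where
  "attempt_time = 1000 * (n * (max 1 k * m ^ 3))"

lemma runs_attempt:
  assumes s: "env \<tau> s" "0 < \<tau>" "nvar s ''f'' = 0" and n: "0 < n"
  shows "runs \<delta> attempt s attempt_time (concluded \<tau>)"
proof -
  let ?T1 = "8 + Suc (k * m) * (100 + n * 100)"
    and ?T2 = "6 + Suc (m * (k * m)) * (160 + m * 20 + n * 70)"
  have m: "0 < m" using colour_less[OF n] by simp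
  have "nvar s ''n'' = n" using s by (simp add: env_def)
  note reset1 = runs_reset_points[OF this, of \<delta>]
  have "runs \<delta> attempt s ((6 + n * 20) + ((6 + m * 30) + (?T1 + ?T2))) (concluded \<tau>)"
    unfolding attempt_def
  proof (rule runs_Seq[OF reset1], elim conjE)
    fix s1 assume fr1: "frame {''i''} {''mark'', ''ch'', ''out''} s s1"
      and z1: "\<forall>q<n. narr s1 ''mark'' q = 0 \<and> narr s1 ''ch'' q = 0 \<and> narr s1 ''out'' q = 0"
    have env1: "env \<tau> s1" using env_frame[OF s(1) fr1] by simp
    then have "nvar s1 ''m'' = m" by (simp add: env_def)
    note reset2 = runs_reset_colours[OF this, of \<delta>]
    show "runs \<delta> (reset_colours ;; build_clusters ;; select_points) s1 ((6 + m * 30) + (?T1 + ?T2)) (concluded \<tau>)"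
    proof (rule runs_Seq[OF reset2], elim conjE)
      fix s2 assume fr2: "frame {''i''} {''cnt'', ''last'', ''h'', ''need''} s1 s2"
        and z2: "\<forall>i<m. narr s2 ''cnt'' i = 0 \<and> narr s2 ''last'' i = 0 \<and> narr s2 ''h'' i = 0 \<and>
          narr s2 ''need'' i = narr s1 ''count'' i"
      have env2: "env \<tau> s2" using env_frame[OF env1 fr2] by simp
      have "runs \<delta> build_clusters s2 ?T1 (\<lambda>s'. clustered \<tau> s' \<and> unselected s' \<and> exhausted s')"
      proof (rule runs_build_clusters[OF env2 s(2)])
        show "nvar s2 ''f'' = 0" using s by (simp add: frameD(2)[OF fr1] frameD(2)[OF fr2])
        show "narr s2 ''mark'' q = 0 \<and> narr s2 ''ch'' q = 0 \<and> narr s2 ''out'' q = 0" if "q < n" for q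
          using z1 that by (simp add: frameD(3)[OF fr2])
        show "narr s2 ''cnt'' i = 0 \<and> narr s2 ''last'' i = 0 \<and> narr s2 ''h'' i = 0 \<and> narr s2 ''need'' i = ks i"
          if "i < m" for i using z2 that env1 by (simp add: env_def)
      qed
      then show "runs \<delta> (build_clusters ;; select_points) s2 (?T1 + ?T2) (concluded \<tau>)"
      proof (rule runs_Seq, elim conjE)
        fix s3 assume s3: "clustered \<tau> s3" "unselected s3" "exhausted s3"
        interpret clustering n m k g ks \<delta> \<tau> "narr s3 ''mark''" "narr s3 ''ch''" "narr s3 ''cnt''" "narr s3 ''last''" "nvar s3 ''c''" "chosen s3"
          using s3 by (simp_all add: clustered_def chosen_def)
        have "selection n m g ks (chosen s3) (narr s3 ''mark'') (narr s3 ''out'') (narr s3 ''own'') (narr s3 ''h'') (narr s3 ''need'')"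
          by (rule selection_initial) (use s3 mark_le in \<open>auto simp: unselected_def\<close>)
        then show "runs \<delta> select_points s3 ?T2 (concluded \<tau>)"
          using s3 by (intro runs_select_points) (simp_all add: matched_def unselected_def)
      qed
    qed
  qed
  moreover have "(6 + n * 20) + ((6 + m * 30) + (?T1 + ?T2)) \<le> attempt_time"
  proof -
    let ?K = "max 1 k" and ?B = "n * (max 1 k * m ^ 3)"
    have K: "k \<le> ?K" "1 \<le> ?K" by auto
    have km: "Suc (k * m) \<le> 2 * (?K * m ^ 2)" "Suc (m * (k * m)) \<le> 2 * (?K * m ^ 2)"
    proof -
      have m2: "m \<le> m ^ 2" "1 \<le> m ^ 2" using m by (simp_all add: power2_eq_square)
      have "k * m \<le> ?K * m ^ 2" by (rule mult_le_mono) (use m2 K in auto)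
      moreover have "1 \<le> ?K * m ^ 2" using mult_le_mono[OF K(2) m2(2)] by simp
      moreover have "m * (k * m) \<le> ?K * m ^ 2" using mult_le_mono1[OF K(1), of "m^2"] by (simp add: power2_eq_square ac_simps)
      ultimately show "Suc (k * m) \<le> 2 * (?K * m ^ 2)" "Suc (m * (k * m)) \<le> 2 * (?K * m ^ 2)" by linarith+
    qed
    \<comment> \<open>Some colours may have no points, so \<open>m\<close> can exceed
      \<open>n\<close> and a scan of points and colours is bounded by a multiple of
      \<open>n * m\<close>. Together with the \<open>m^2\<close> from the number of rounds this
      gives \<open>m^3\<close>.\<close>
    have nm: "n \<le> n * m" "m \<le> n * m" "1 \<le> n * m" using n m by (simp_all add: Suc_le_eq)
    have "Suc (k * m) * (100 + n * 100) \<le> 2 * (?K * m ^ 2) * (200 * (n * m))"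
      by (rule mult_le_mono[OF km(1)]) (use nm in linarith)
    also have "\<dots> = 400 * ?B" by (simp add: power2_eq_square power3_eq_cube ac_simps)
    finally have 1: "Suc (k * m) * (100 + n * 100) \<le> 400 * ?B" .
    have "Suc (m * (k * m)) * (160 + m * 20 + n * 70) \<le> 2 * (?K * m ^ 2) * (250 * (n * m))"
      by (rule mult_le_mono[OF km(2)]) (use nm in linarith)
    also have "\<dots> = 500 * ?B" by (simp add: power2_eq_square power3_eq_cube ac_simps)
    finally have 2: "Suc (m * (k * m)) * (160 + m * 20 + n * 70) \<le> 500 * ?B" .
    have "1 * (n * m) \<le> (?K * m ^ 2) * (n * m)" by (rule mult_le_mono1) (use km in linarith)
    then have "n * m \<le> ?B" by (simp add: power2_eq_square power3_eq_cube ac_simps)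
    then show ?thesis unfolding attempt_time_def using 1 2 nm by linarith
  qed
  ultimately show ?thesis by (rule runs_mono) auto
qed

end

section \<open>The sequence of attempts\<close>

context indexed_run
begin

lemma radius_unique:
  assumes "radius \<delta> n r" "radius \<delta> n r'" "0 < n"
  shows "r = r'"
proof (rule antisym)
  have "0 \<le> r" "0 \<le> r'" using assms dist_same[of 0] by (auto simp: radius_def)
  then show "r \<le> r'" "r' \<le> r" using assms by (auto simp: radius_def)
qed

text \<open>\<open>J\<close> is known only to the analysis: \<open>M\<close> guarantees success in
  attempt \<open>J\<close>, and an earlier success has an even larger threshold. Of the factor
  \<open>Suc (Suc J)\<close>, one unit pays for the preparation and the final test, the rest for
  attempts \<open>0\<close> to \<open>J\<close>.\<close>

lemma runs_fair_program:
  assumes s: "nvar s ''n'' = n" "nvar s ''m'' = m" "nvar s ''k'' = 0" "nvar s ''f'' = 0"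
      "narr s ''group'' = g" "narr s ''count'' = ks" "rvar s ''t'' = 0" "rvar s ''eps'' = \<epsilon>"
    and n: "0 < n" and r: "radius \<delta> n r" "0 < r"
    and M: "fair_indices n m g ks M" "separated \<delta> (2 * r / (1 + \<epsilon>) ^ J) M"
  shows "runs \<delta> fair_program s (1100 * (Suc (Suc J) * (n * (max 1 k * m ^ 3))))
    (\<lambda>s'. \<exists>j\<le>J. fair_indices n m g ks {q. q < n \<and> narr s' ''out'' q \<noteq> 0} \<and>
      separated \<delta> (2 * r / (real m + 1) / (1 + \<epsilon>) ^ j) {q. q < n \<and> narr s' ''out'' q \<noteq> 0})"
    (is "runs _ _ _ _ ?Q")
proof -
  let ?T = "\<lambda>j. 2 * r / (real m + 1) / (1 + \<epsilon>) ^ j"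
  let ?F = "attempt ;; RAssign ''t'' (RDiv (RVar ''t'') (RAdd (OfNat (NLit 1)) (RVar ''eps'')))"
  let ?I = "\<lambda>v s. if nvar s ''f'' = 0 then \<exists>j\<le>J. v = Suc J - j \<and> env (?T j) s else ?Q s"
  have eps: "0 < 1 + \<epsilon>" using accuracy_pos by simp
  have T_pos: "0 < ?T j" for j using r eps by (simp add: add_nonneg_pos)
  have body: "runs \<delta> ?F s (attempt_time + 10) (\<lambda>s'. if nvar s' ''f'' = 0 then j < J \<and> env (?T (Suc j)) s' else ?Q s')"
    if s: "env (?T j) s" "nvar s ''f'' = 0" and j: "j \<le> J" for s j
  proof (rule runs_Seq[OF runs_attempt[OF s(1) T_pos s(2) n]])
    fix s' assume c: "concluded (?T j) s'"
    let ?s = "s'\<lparr>rvar := (rvar s')(''t'' := ?T (Suc j))\<rparr>"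
    have "rvar s' ''t'' = ?T j" "rvar s' ''eps'' = \<epsilon>" using c by (simp_all add: concluded_def env_def)
    then have run: "runs \<delta> (RAssign ''t'' (RDiv (RVar ''t'') (RAdd (OfNat (NLit 1)) (RVar ''eps'')))) s' 10 (\<lambda>s'. s' = ?s)"
      by (simp add: runs_def wp_simps field_simps)
    have post: "if nvar ?s ''f'' = 0 then j < J \<and> env (?T (Suc j)) ?s else ?Q ?s"
    proof (cases "nvar s' ''f'' = 0")
      case True
      then have "\<not> separated \<delta> ((real m + 1) * ?T j) M" using c M(1) by (simp add: concluded_def)
      moreover have "(real m + 1) * ?T j = 2 * r / (1 + \<epsilon>) ^ j"
      proof -
        have "x * (y / x / z) = y / z" if "x \<noteq> 0" for x y z :: real using that by simp
        then show ?thesis using of_nat_0_le_iff[of m, where 'a = real] by (metis add.commute add_nonneg_eq_0_iff zero_le_one zero_neq_one)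
      qed
      ultimately have "\<not> separated \<delta> (2 * r / (1 + \<epsilon>) ^ j) M" by simp
      then have "j < J" using M(2) j by (metis le_neq_implies_less)
      then show ?thesis using True c by (simp add: concluded_def env_def)
    next
      case False
      then show ?thesis using c j by (auto simp: concluded_def)
    qed
    show "runs \<delta> (RAssign ''t'' (RDiv (RVar ''t'') (RAdd (OfNat (NLit 1)) (RVar ''eps'')))) s' 10
      (\<lambda>s'. if nvar s' ''f'' = 0 then j < J \<and> env (?T (Suc j)) s' else ?Q s')"
      by (rule runs_mono[OF run le_refl], erule ssubst, rule post)
  qed
  have loop: "runs \<delta> (Loop (NEq (NVar ''f'') (NLit 0)) ?F) s
      ((1 + bcost (NEq (NVar ''f'') (NLit 0))) +
        Suc J * (1 + bcost (NEq (NVar ''f'') (NLit 0)) + (attempt_time + 10))) ?Q"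
    if s: "env (?T 0) s" "nvar s ''f'' = 0" for s
  proof (rule runs_Loop[where I = ?I])
    show "?I (Suc J) s" using s by auto
  next
    fix v s assume I: "?I v s" and "bval \<delta> (NEq (NVar ''f'') (NLit 0)) s"
    then have f: "nvar s ''f'' = 0" by simp
    then obtain j where j: "j \<le> J" "v = Suc J - j" "env (?T j) s" using I by auto
    have "runs \<delta> ?F s (attempt_time + 10) (\<lambda>s'. \<exists>w<v. ?I w s')"
      using body[OF j(3) f j(1)]
    proof (rule runs_mono)
      fix s' assume s': "if nvar s' ''f'' = 0 then j < J \<and> env (?T (Suc j)) s' else ?Q s'"
      have "?I (v - 1) s'"
      proof (cases "nvar s' ''f'' = 0")
        case True
        then have "Suc j \<le> J" "v - 1 = Suc J - Suc j" "env (?T (Suc j)) s'" using s' j by auto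
        then show ?thesis using True by auto
      qed (use s' in simp)
      moreover have "v - 1 < v" using j by simp
      ultimately show "\<exists>w<v. ?I w s'" by blast
    qed simp
    then show "0 < v \<and> runs \<delta> ?F s (attempt_time + 10) (\<lambda>s'. \<exists>w<v. ?I w s')" using j by simp
  next
    fix v s assume I: "?I v s" and "\<not> bval \<delta> (NEq (NVar ''f'') (NLit 0)) s"
    then have "nvar s ''f'' \<noteq> 0" by simp
    then show "?Q s" using I by simp
  qed
  have "runs \<delta> fair_program s ((6 + m * 20) + ((30 + n * 25) + ((1 + bcost (NEq (NVar ''f'') (NLit 0))) +
        Suc J * (1 + bcost (NEq (NVar ''f'') (NLit 0)) + (attempt_time + 10))))) ?Q"
    unfolding fair_program_def
  proof (rule runs_Seq[OF runs_sum_counts[OF s(2,3)]], elim conjE)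
    fix s1 assume fr: "frame {''i'', ''k''} {} s s1" and k1: "nvar s1 ''k'' = (\<Sum>i<m. narr s ''count'' i)"
    have s1: "nvar s1 ''n'' = n" "rvar s1 ''t'' = 0" using s by (simp_all add: frameD[OF fr])
    show "runs \<delta> (initial_threshold ;; Loop (NEq (NVar ''f'') (NLit 0)) ?F) s1
      ((30 + n * 25) + ((1 + bcost (NEq (NVar ''f'') (NLit 0))) +
        Suc J * (1 + bcost (NEq (NVar ''f'') (NLit 0)) + (attempt_time + 10)))) ?Q"
    proof (rule runs_Seq[OF runs_initial_threshold[OF s1]], elim exE conjE)
      fix s2 r' assume "radius \<delta> n r'" and s2: "s2 = s1\<lparr>nvar := (nvar s1)(''i'' := n),
        rvar := (rvar s1)(''t'' := 2 * r' / (real (nvar s1 ''m'') + 1))\<rparr>"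
      then have "r' = r" using radius_unique r n by blast
      then have "env (?T 0) s2" "nvar s2 ''f'' = 0"
        using s k1 total_count[symmetric] unfolding s2 by (simp_all add: env_def frameD[OF fr])
      then show "runs \<delta> (Loop (NEq (NVar ''f'') (NLit 0)) ?F) s2 ((1 + bcost (NEq (NVar ''f'') (NLit 0))) +
        Suc J * (1 + bcost (NEq (NVar ''f'') (NLit 0)) + (attempt_time + 10))) ?Q"
        by (rule loop)
    qed
  qed
  moreover have "(6 + m * 20) + ((30 + n * 25) + ((1 + bcost (NEq (NVar ''f'') (NLit 0))) +
        Suc J * (1 + bcost (NEq (NVar ''f'') (NLit 0)) + (attempt_time + 10))))
      \<le> 1100 * (Suc (Suc J) * (n * (max 1 k * m ^ 3)))"
  proof -
    let ?B = "n * (max 1 k * m ^ 3)"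
    have m: "0 < m" using colour_less[OF n] by simp
    have "1 \<le> max 1 k * m ^ 3" using m by (simp add: Suc_le_eq)
    then have nB: "n \<le> ?B" by simp
    have "m * 1 \<le> m ^ 3 * (n * max 1 k)"
      by (rule mult_le_mono) (use m n in \<open>simp_all add: Suc_le_eq self_le_power\<close>)
    then have mB: "m \<le> ?B" by (simp add: ac_simps)
    define B where "B = ?B"
    have B: "1 \<le> B" "n \<le> B" "m \<le> B" using nB mB n unfolding B_def by linarith+
    have "attempt_time = 1000 * B" by (simp add: attempt_time_def B_def)
    then have "1 + bcost (NEq (NVar ''f'') (NLit 0)) + (attempt_time + 10) \<le> 1100 * B"
      using B by simp
    then have "Suc J * (1 + bcost (NEq (NVar ''f'') (NLit 0)) + (attempt_time + 10)) \<le> Suc J * (1100 * B)"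
      by (rule mult_le_mono2)
    moreover have "1100 * (Suc (Suc J) * B) = 1100 * B + Suc J * (1100 * B)" by simp
    moreover have "bcost (NEq (NVar ''f'') (NLit 0)) = 3" by simp
    ultimately show ?thesis using B unfolding B_def[symmetric] by linarith
  qed
  ultimately show ?thesis by (rule runs_mono)
qed

end

section \<open>Translation between index sets and diversity of point sets\<close>

lemma ereal_le_diversity_iff:
  assumes "bij_betw pts {..<n} X" "M \<subseteq> {..<n}"
  shows "ereal x \<le> diversity d (pts ` M) \<longleftrightarrow> separated (oracle_of d pts) x M"
proof -
  have inj: "pts p = pts q \<longleftrightarrow> p = q" if "p \<in> M" "q \<in> M" for p q
    using assms that by (meson bij_betw_imp_inj_on inj_onD subsetD)
  have "ereal x \<le> diversity d (pts ` M) \<longleftrightarrow>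
      (\<forall>u\<in>pts ` M. \<forall>v\<in>pts ` M. u \<noteq> v \<longrightarrow> ereal x \<le> ereal (d u v))"
    unfolding diversity_def le_Inf_iff by blast
  also have "\<dots> \<longleftrightarrow> separated (oracle_of d pts) x M"
    using inj by (simp add: separated_def oracle_of_def)
  finally show ?thesis .
qed

lemma diversity_infinity_iff:
  "diversity d S = \<infinity> \<longleftrightarrow> (\<forall>u\<in>S. \<forall>v\<in>S. u = v)"
proof -
  have "diversity d S = \<infinity> \<longleftrightarrow> (\<forall>u\<in>S. \<forall>v\<in>S. u \<noteq> v \<longrightarrow> ereal (d u v) = \<infinity>)"
    unfolding diversity_def top_ereal_def[symmetric] Inf_top_conv by blast
  then show ?thesis by simp
qed

lemma (in fair_instance) opt_diversity_attained:
  obtains S where "S \<subseteq> X" "\<And>i. i < m \<Longrightarrow> card (S \<inter> G i) = ks i" "opt_diversity X d m G ks = diversity d S"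
proof -
  let ?F = "{S. S \<subseteq> X \<and> (\<forall>i<m. card (S \<inter> G i) = ks i)}"
  have "finite (Pow X)" using finite_points by simp
  then have "finite ?F" by (rule finite_subset[rotated]) auto
  moreover have "?F \<noteq> {}"
  proof -
    have "\<exists>A. A \<subseteq> G i \<and> card A = ks i" if "i < m" for i
      using obtain_subset_with_card_n[OF counts_feasible[OF that]] by metis
    then obtain A where A: "\<And>i. i < m \<Longrightarrow> A i \<subseteq> G i \<and> card (A i) = ks i" by metis
    have "(\<Union>j<m. A j) \<inter> G i = A i" if "i < m" for i
    proof -
      have "A j \<inter> G i = {}" if "j < m" "j \<noteq> i" for j
        using A[OF that(1)] groups_disjoint \<open>i < m\<close> that unfolding disjoint_family_on_def by blast
      then show ?thesis using A \<open>i < m\<close> by blast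
    qed
    then have "(\<Union>j<m. A j) \<in> ?F" using A groups_cover by auto
    then show ?thesis by blast
  qed
  ultimately have "opt_diversity X d m G ks \<in> diversity d ` ?F"
    unfolding opt_diversity_def by (intro Max_in) auto
  then show thesis using that by auto
qed

section \<open>Approximation ratio and running time\<close>

text \<open>The least possible growth of \<open>ln (1 + \<epsilon>)\<close> is linear only for
  bounded \<epsilon>, which is why the constant depends on \<open>\<epsilon>\<^sub>0\<close>.
  Constants independent of \<open>n\<close> are absorbed through \<open>ln n \<ge> ln 2\<close>, and
  \<open>max a 1\<close> keeps the logarithm nonnegative.\<close>

lemma iteration_bound:
  fixes \<epsilon> \<epsilon>\<^sub>0 a :: real and n J c :: nat
  assumes eps: "0 < \<epsilon>" "\<epsilon> \<le> \<epsilon>\<^sub>0" and n: "2 \<le> n"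
    and J: "J = 0 \<or> (1 + \<epsilon>) ^ (J - 1) \<le> 2 * (a * real n ^ c)"
  shows "real (Suc (Suc J)) \<le> (3 * \<epsilon>\<^sub>0 / ln 2 + (1 + \<epsilon>\<^sub>0) * (ln (2 * max a 1) / ln 2 + c)) * (1 / \<epsilon>) * ln (real n)"
proof -
  define L where "L = ln (real n)"
  let ?A = "ln (2 * max a 1)"
  have A: "0 \<le> ?A" by (rule ln_ge_zero) auto
  have ln2: "0 < ln (2::real)" by simp
  have L: "ln 2 \<le> L" using n by (simp add: L_def)
  then have L0: "0 \<le> L" using ln2 by linarith
  have one: "1 \<le> L / ln 2" using L ln2 by (simp add: le_divide_eq)
  have pos: "0 \<le> (1 + \<epsilon>\<^sub>0) / \<epsilon> * (?A + c * L)"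
    using A L0 eps by (intro mult_nonneg_nonneg divide_nonneg_nonneg add_nonneg_nonneg) auto
  have Jle: "real J \<le> 1 + (1 + \<epsilon>\<^sub>0) / \<epsilon> * (?A + c * L)"
  proof (cases "J = 0")
    case True
    then show ?thesis using pos by simp
  next
    case False
    then have "(1 + \<epsilon>) ^ (J - 1) \<le> 2 * (a * real n ^ c)" using J by blast
    also have "\<dots> \<le> (2 * max a 1) * real n ^ c" by (simp add: mult_right_mono)
    finally have "ln ((1 + \<epsilon>) ^ (J - 1)) \<le> ln ((2 * max a 1) * real n ^ c)"
      using eps n by (subst ln_le_cancel_iff) auto
    also have "\<dots> = ?A + c * L" using n by (simp add: ln_mult_pos ln_realpow L_def)
    finally have 1: "real (J - 1) * ln (1 + \<epsilon>) \<le> ?A + c * L" using eps by (simp add: ln_realpow)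
    \<comment> \<open>The bound \<open>ln x \<le> x - 1\<close> at the reciprocal turns into the
      lower bound \<open>\<epsilon> / (1 + \<epsilon>)\<close> for
      \<open>ln (1 + \<epsilon>)\<close>.\<close>
    have "ln (1 / (1 + \<epsilon>)) \<le> 1 / (1 + \<epsilon>) - 1" by (rule ln_le_minus_one) (use eps in simp)
    moreover have "ln (1 / (1 + \<epsilon>)) = - ln (1 + \<epsilon>)" using eps by (simp add: ln_div)
    moreover have "1 / (1 + \<epsilon>) - 1 = - (\<epsilon> / (1 + \<epsilon>))" using eps by (simp add: field_simps)
    ultimately have "\<epsilon> / (1 + \<epsilon>) \<le> ln (1 + \<epsilon>)" by simp
    moreover have "\<epsilon> / (1 + \<epsilon>\<^sub>0) \<le> \<epsilon> / (1 + \<epsilon>)" using eps by (intro divide_left_mono) auto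
    ultimately have "\<epsilon> / (1 + \<epsilon>\<^sub>0) \<le> ln (1 + \<epsilon>)" by simp
    then have "real (J - 1) * (\<epsilon> / (1 + \<epsilon>\<^sub>0)) \<le> ?A + c * L"
      using 1 mult_left_mono[of "\<epsilon> / (1 + \<epsilon>\<^sub>0)" "ln (1 + \<epsilon>)" "real (J - 1)"] by simp
    then have "real (J - 1) * \<epsilon> \<le> (?A + c * L) * (1 + \<epsilon>\<^sub>0)"
      using eps by (simp add: field_simps)
    then have "real (J - 1) \<le> (1 + \<epsilon>\<^sub>0) / \<epsilon> * (?A + c * L)"
      using eps by (simp add: field_simps)
    then show ?thesis using False by (simp add: of_nat_diff)
  qed
  have "?A + c * L \<le> ?A / ln 2 * L + c * L"
  proof -
    have "?A * 1 \<le> ?A * (L / ln 2)" by (rule mult_left_mono[OF one A])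
    then show ?thesis by simp
  qed
  then have "(1 + \<epsilon>\<^sub>0) / \<epsilon> * (?A + c * L) \<le> (1 + \<epsilon>\<^sub>0) / \<epsilon> * (?A / ln 2 * L + c * L)"
    by (rule mult_left_mono) (use eps in simp)
  then have "real J \<le> 1 + (1 + \<epsilon>\<^sub>0) / \<epsilon> * (?A / ln 2 * L + c * L)"
    using Jle by linarith
  \<comment> \<open>Three units are absorbed this way: the two successors and the 1 in the bound for
    \<open>J\<close>. This is the origin of the coefficient 3.\<close>
  moreover have "1 \<le> \<epsilon>\<^sub>0 / \<epsilon> * (L / ln 2)"
  proof -
    have "1 * 1 \<le> \<epsilon>\<^sub>0 / \<epsilon> * (L / ln 2)" by (rule mult_mono) (use eps one in auto)
    then show ?thesis by simp
  qed
  ultimately have "real (Suc (Suc J)) \<le> 3 * (\<epsilon>\<^sub>0 / \<epsilon> * (L / ln 2)) + (1 + \<epsilon>\<^sub>0) / \<epsilon> * (?A / ln 2 * L + c * L)"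
    by simp
  also have "\<dots> = (3 * \<epsilon>\<^sub>0 / ln 2 + (1 + \<epsilon>\<^sub>0) * (?A / ln 2 + c)) * (1 / \<epsilon>) * L"
    using eps by (simp add: field_simps)
  finally show ?thesis by (simp add: L_def)
qed

locale enumerated_instance = fair_instance +
  fixes n k :: nat and pts :: "nat \<Rightarrow> 'a" and \<epsilon> :: real
  assumes n_eq: "n = card X" and k_eq: "k = (\<Sum>i<m. ks i)" and two_points: "2 \<le> n"
    and enum: "bij_betw pts {..<n} X" and eps_pos: "0 < \<epsilon>"
begin

text \<open>Repeats the \<open>group\<close> array of \<open>input_state\<close>, with its zeros
  beyond \<open>n\<close>, since \<open>env\<close> compares arrays as whole functions.
  \<open>required\<close> does the same for \<open>count\<close>.\<close>

definition colour :: "nat \<Rightarrow> nat" where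
  "colour p = (if p < n then THE i. i < m \<and> pts p \<in> G i else 0)"

definition required :: "nat \<Rightarrow> nat" where
  "required i = (if i < m then ks i else 0)"

lemma pts_in: "p < n \<Longrightarrow> pts p \<in> X"
  using enum by (auto simp: bij_betw_def)

lemma pts_inj: "inj_on pts {..<n}"
  using enum by (auto simp: bij_betw_def)

lemma colour_iff:
  assumes "p < n" "i < m"
  shows "colour p = i \<longleftrightarrow> pts p \<in> G i"
proof -
  obtain j where j: "j < m" "pts p \<in> G j" using pts_in[OF assms(1)] groups_cover by blast
  have uniq: "i' = j" if "i' < m" "pts p \<in> G i'" for i'
    using groups_disjoint j that unfolding disjoint_family_on_def by blast
  have "(THE i. i < m \<and> pts p \<in> G i) = j" by (rule the_equality) (use j uniq in blast)+
  then have "colour p = j" using assms(1) by (simp add: colour_def)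
  then show ?thesis using j uniq[of i] assms(2) by blast
qed

lemma colour_less: "p < n \<Longrightarrow> colour p < m"
  using pts_in[of p] groups_cover colour_iff[of p] by blast

sublocale run: indexed_run n m k colour required "oracle_of d pts" \<epsilon>
proof
  show "k = (\<Sum>i<m. required i)" by (simp add: k_eq required_def)
qed (use colour_less pts_in eps_pos commute triangle in \<open>auto simp: oracle_of_def\<close>)

lemma card_group_image:
  assumes "M \<subseteq> {..<n}" "i < m"
  shows "card (pts ` M \<inter> G i) = card {q \<in> M. colour q = i}"
proof -
  have "pts ` M \<inter> G i = pts ` {q \<in> M. colour q = i}" using assms colour_iff by blast
  moreover have "inj_on pts {q \<in> M. colour q = i}" using assms by (blast intro: inj_on_subset[OF pts_inj])
  ultimately show ?thesis by (simp add: card_image)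
qed

lemma fair_indices_iff:
  "M \<subseteq> {..<n} \<Longrightarrow> fair_indices n m colour required M \<longleftrightarrow> (\<forall>i<m. card (pts ` M \<inter> G i) = ks i)"
  by (simp add: fair_indices_def card_group_image required_def)

lemma card_fair_indices: "fair_indices n m colour required M \<Longrightarrow> card M = k"
proof -
  assume M: "fair_indices n m colour required M"
  then have sub: "M \<subseteq> {..<n}" by (simp add: fair_indices_def)
  then have "{q \<in> M. colour q \<in> {..<m}} = M" using colour_less by auto
  then have "card M = (\<Sum>i<m. card {q \<in> M. colour q = i})"
    using card_eq_sum_colours[of M "{..<m}" colour] finite_subset[OF sub] by simp
  also have "\<dots> = k" using M by (simp add: fair_indices_def k_eq required_def)
  finally show ?thesis .
qed

text \<open>Being positive, \<open>r\<close> is attained by a pair of distinct points, so the aspect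
  ratio controls it; the triangle inequality through the first point gives the factor 2.\<close>

lemma radius_bounds:
  assumes r: "radius (oracle_of d pts) n r" and D: "D = {d u v |u v. u \<in> X \<and> v \<in> X \<and> u \<noteq> v}"
  shows "0 < r" "r \<le> Max D" "0 < Min D" "finite D" "\<And>u v. u \<in> X \<Longrightarrow> v \<in> X \<Longrightarrow> d u v \<le> 2 * r"
proof -
  have "D \<subseteq> (\<lambda>(u, v). d u v) ` (X \<times> X)" unfolding D by auto
  then show fin: "finite D" by (rule finite_subset) (use finite_points in simp)
  have ne: "pts 0 \<noteq> pts 1" using inj_onD[OF pts_inj, of 0 1] two_points by auto
  have X: "pts 0 \<in> X" "pts 1 \<in> X" using pts_in two_points by auto
  then have d01: "d (pts 0) (pts 1) \<in> D" using ne unfolding D by blast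
  have pos: "0 < x" if "x \<in> D" for x
    using that unfolding D by (auto simp: less_le)
  show "0 < Min D" using pos Min_in[OF fin] d01 by blast
  have "d (pts 0) (pts 1) \<le> r" using r two_points by (simp add: radius_def oracle_of_def)
  then show r0: "0 < r" using pos[OF d01] by simp
  then obtain q where q: "q < n" "r = d (pts 0) (pts q)" using r by (auto simp: radius_def oracle_of_def)
  have "pts 0 \<noteq> pts q" using r0 q X by auto
  then have "r \<in> D" using q X pts_in unfolding D by blast
  then show "r \<le> Max D" using fin by simp
  show "d u v \<le> 2 * r" if "u \<in> X" "v \<in> X" for u v
  proof -
    have le: "d (pts 0) w \<le> r" if "w \<in> X" for w
      using enum that r by (auto simp: bij_betw_def radius_def oracle_of_def)
    have "d u v \<le> d u (pts 0) + d (pts 0) v" using triangle that X by blast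
    also have "\<dots> \<le> r + r" using le[OF that(1)] le[OF that(2)] commute[of u "pts 0"] by simp
    finally show ?thesis by simp
  qed
qed

lemma correct:
  assumes eps: "\<epsilon> \<le> \<epsilon>\<^sub>0" and aspect: "aspect_ratio X d \<le> a * real n ^ c"
  defines "C \<equiv> 1100 * (3 * \<epsilon>\<^sub>0 / ln 2 + (1 + \<epsilon>\<^sub>0) * (ln (2 * max a 1) / ln 2 + c))"
  shows "\<exists>t s S. exec (oracle_of d pts) fair_program (input_state n m G ks pts \<epsilon>) t s \<and>
          S = output_set n pts s \<and> S \<subseteq> X \<and>
          diversity d S \<ge> opt_diversity X d m G ks / ereal ((real m + 1) * (1 + \<epsilon>)) \<and>
          (\<forall>i<m. card (S \<inter> G i) \<ge> ks i) \<and>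
          real t \<le> C * (real n * real (max 1 k) * real m ^ 3 * (1 / \<epsilon>) * ln (real n))"
proof -
  let ?\<delta> = "oracle_of d pts" and ?s = "input_state n m G ks pts \<epsilon>"
  define D where "D = {d u v |u v. u \<in> X \<and> v \<in> X \<and> u \<noteq> v}"
  have "\<exists>r. radius ?\<delta> n r"
  proof -
    have fin: "finite (?\<delta> 0 ` {..<n})" and ne: "?\<delta> 0 ` {..<n} \<noteq> {}"
      using two_points by (simp_all add: lessThan_empty_iff)
    have "radius ?\<delta> n (Max (?\<delta> 0 ` {..<n}))"
      using Max_ge[OF fin] Max_in[OF fin ne] by (auto simp: radius_def)
    then show ?thesis ..
  qed
  then obtain r where r: "radius ?\<delta> n r" ..
  note rb = radius_bounds[OF r D_def]
  obtain Opt where Opt: "Opt \<subseteq> X" "\<And>i. i < m \<Longrightarrow> card (Opt \<inter> G i) = ks i"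
    "opt_diversity X d m G ks = diversity d Opt" using opt_diversity_attained by blast
  define M where "M = {q. q < n \<and> pts q \<in> Opt}"
  have M: "M \<subseteq> {..<n}" by (auto simp: M_def)
  have ptsM: "pts ` M = Opt" using Opt(1) enum by (auto simp: M_def bij_betw_def)
  have fairM: "fair_indices n m colour required M" using Opt(2) by (simp add: fair_indices_iff[OF M] ptsM)
  have sepM: "separated ?\<delta> x M \<longleftrightarrow> ereal x \<le> diversity d Opt" for x
    using ereal_le_diversity_iff[OF enum M, of x d] ptsM by simp
  have low: "ereal (Min D) \<le> diversity d Opt"
    unfolding diversity_def
  proof (rule Inf_greatest)
    fix x assume "x \<in> {ereal (d u v) |u v. u \<in> Opt \<and> v \<in> Opt \<and> u \<noteq> v}"
    then obtain y where "x = ereal y" "y \<in> D" using Opt(1) unfolding D_def by blast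
    then show "ereal (Min D) \<le> x" using rb(4) by simp
  qed
  let ?P = "\<lambda>j. ereal (2 * r / (1 + \<epsilon>) ^ j) \<le> diversity d Opt"
  have "\<exists>j. ?P j"
  proof -
    obtain j where "2 * r / Min D < (1 + \<epsilon>) ^ j" using real_arch_pow[of "1 + \<epsilon>"] eps_pos by auto
    then have "2 * r / (1 + \<epsilon>) ^ j \<le> Min D" using rb eps_pos by (simp add: field_simps)
    then show ?thesis using low by (metis ereal_less_eq(3) order_trans)
  qed
  \<comment> \<open>Leastness serves twice: failure at \<open>J - 1\<close> bounds \<open>J\<close>
    by the aspect ratio, and it shows that stopping at \<open>J\<close> overshoots the optimum by at
    most one factor \<open>1 + \<epsilon>\<close>.\<close>
  define J where "J = (LEAST j. ?P j)"
  have PJ: "?P J" unfolding J_def using \<open>\<exists>j. ?P j\<close> by (rule LeastI_ex)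
  have notP: "\<not> ?P (J - 1)" if "J \<noteq> 0"
    unfolding J_def by (rule not_less_Least) (use that in \<open>simp add: J_def\<close>)
  have ratio: "r \<le> a * real n ^ c * Min D"
  proof -
    have "Max D / Min D \<le> a * real n ^ c" using aspect by (simp add: aspect_ratio_def D_def Let_def)
    then show ?thesis using rb(2,3) by (simp add: divide_le_eq)
  qed
  have Jbound: "J = 0 \<or> (1 + \<epsilon>) ^ (J - 1) \<le> 2 * (a * real n ^ c)"
  proof (cases "J = 0")
    case False
    have "ereal (Min D) < ereal (2 * r / (1 + \<epsilon>) ^ (J - 1))"
      using notP[OF False] low by (meson le_less_trans not_le)
    then have "Min D * (1 + \<epsilon>) ^ (J - 1) < 2 * r" using eps_pos by (simp add: field_simps)
    also have "\<dots> \<le> Min D * (2 * (a * real n ^ c))" using ratio by (simp add: ac_simps)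
    finally show ?thesis using rb(3) by simp
  qed simp
  have "runs ?\<delta> fair_program ?s (1100 * (Suc (Suc J) * (n * (max 1 k * m ^ 3))))
    (\<lambda>s'. \<exists>j\<le>J. fair_indices n m colour required {q. q < n \<and> narr s' ''out'' q \<noteq> 0} \<and>
      separated ?\<delta> (2 * r / (real m + 1) / (1 + \<epsilon>) ^ j) {q. q < n \<and> narr s' ''out'' q \<noteq> 0})"
  proof (rule run.runs_fair_program[OF _ _ _ _ _ _ _ _ _ r rb(1) fairM])
    show "separated ?\<delta> (2 * r / (1 + \<epsilon>) ^ J) M" using PJ sepM by blast
  qed (use two_points in \<open>auto simp: input_state_def colour_def required_def fun_eq_iff\<close>)
  then obtain t s j where t: "exec ?\<delta> fair_program ?s t s" "t \<le> 1100 * (Suc (Suc J) * (n * (max 1 k * m ^ 3)))"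
    and j: "j \<le> J" and fair: "fair_indices n m colour required {q. q < n \<and> narr s ''out'' q \<noteq> 0}"
    and sep: "separated ?\<delta> (2 * r / (real m + 1) / (1 + \<epsilon>) ^ j) {q. q < n \<and> narr s ''out'' q \<noteq> 0}"
    unfolding runs_iff by blast
  define N where "N = {q. q < n \<and> narr s ''out'' q \<noteq> 0}"
  have N: "N \<subseteq> {..<n}" by (auto simp: N_def)
  have out: "output_set n pts s = pts ` N" by (simp add: output_set_def N_def)
  have "opt_diversity X d m G ks / ereal ((real m + 1) * (1 + \<epsilon>)) \<le> diversity d (pts ` N)"
  proof (cases "diversity d Opt = \<infinity>")
    case True
    have "finite Opt" using Opt(1) finite_points by (rule finite_subset)
    \<comment> \<open>An infinite optimum has at most one point, and the output has the same
      cardinality, so its diversity is infinite as well.\<close>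
    then have "card Opt \<le> 1" using True by (simp add: diversity_infinity_iff card_le_Suc0_iff_eq)
    moreover have "card Opt = card M" unfolding ptsM[symmetric]
      by (rule card_image) (use M in \<open>blast intro: inj_on_subset[OF pts_inj]\<close>)
    moreover have "card M = card N" using card_fair_indices fairM fair by (simp add: N_def)
    moreover have "finite N" using N by (rule finite_subset) simp
    ultimately have "\<forall>p\<in>N. \<forall>q\<in>N. p = q" using card_le_Suc0_iff_eq[of N] by simp
    then have "\<forall>u\<in>pts ` N. \<forall>v\<in>pts ` N. u = v" by (metis imageE)
    then have "diversity d (pts ` N) = \<infinity>" by (rule iffD2[OF diversity_infinity_iff])
    then show ?thesis by simp
  next
    case False
    then obtain u v where uv: "u \<in> Opt" "v \<in> Opt" "u \<noteq> v" by (auto simp: diversity_infinity_iff)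
    have "diversity d Opt \<le> ereal (d u v)" unfolding diversity_def by (rule Inf_lower) (use uv in blast)
    also have "\<dots> \<le> ereal (2 * r)" using rb(5) uv Opt(1) by auto
    finally have up: "diversity d Opt \<le> ereal (2 * r)" .
    obtain l where l: "diversity d Opt = ereal l" using low False by (cases "diversity d Opt") auto
    have eps1: "0 < 1 + \<epsilon>" "1 \<le> 1 + \<epsilon>" using eps_pos by auto
    \<comment> \<open>For \<open>J = 0\<close> the optimum is at most \<open>2 * r\<close> outright;
      otherwise it lies below the previous, larger candidate.\<close>
    have "l / (1 + \<epsilon>) \<le> 2 * r / (1 + \<epsilon>) ^ J"
    proof (cases J)
      case 0
      have "0 \<le> l" using low rb(3) l by simp
      then have "l / (1 + \<epsilon>) \<le> l / 1" using eps1 by (intro divide_left_mono) auto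
      then show ?thesis using up l 0 by simp
    next
      case (Suc i)
      then have "l \<le> 2 * r / (1 + \<epsilon>) ^ i" using notP l by simp
      then have "l / (1 + \<epsilon>) \<le> 2 * r / (1 + \<epsilon>) ^ i / (1 + \<epsilon>)" by (rule divide_right_mono) (use eps1 in simp)
      then show ?thesis using Suc by (simp add: mult.commute)
    qed
    also have "\<dots> \<le> 2 * r / (1 + \<epsilon>) ^ j"
      by (rule divide_left_mono) (use rb(1) eps1 j in \<open>auto intro: power_increasing mult_pos_pos\<close>)
    finally have "l / (1 + \<epsilon>) / (real m + 1) \<le> 2 * r / (1 + \<epsilon>) ^ j / (real m + 1)"
      by (rule divide_right_mono) simp
    then have le: "l / ((real m + 1) * (1 + \<epsilon>)) \<le> 2 * r / (real m + 1) / (1 + \<epsilon>) ^ j"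
      by (simp add: ac_simps)
    have "(real m + 1) * (1 + \<epsilon>) \<noteq> 0" using eps1 by (simp add: add_nonneg_eq_0_iff)
    then have "opt_diversity X d m G ks / ereal ((real m + 1) * (1 + \<epsilon>)) = ereal (l / ((real m + 1) * (1 + \<epsilon>)))"
      using Opt(3) l by simp
    also have "\<dots> \<le> ereal (2 * r / (real m + 1) / (1 + \<epsilon>) ^ j)" using le by simp
    also have "\<dots> \<le> diversity d (pts ` N)"
      using sep ereal_le_diversity_iff[OF enum N] by (simp add: N_def)
    finally show ?thesis .
  qed
  moreover have "pts ` N \<subseteq> X" using N pts_in by auto
  moreover have "\<forall>i<m. ks i \<le> card (pts ` N \<inter> G i)"
    using fair fair_indices_iff[OF N] by (simp add: N_def)
  moreover have "real t \<le> C * (real n * real (max 1 k) * real m ^ 3 * (1 / \<epsilon>) * ln (real n))"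
  proof -
    let ?B = "real n * real (max 1 k) * real m ^ 3"
    have "real t \<le> real (1100 * (Suc (Suc J) * (n * (max 1 k * m ^ 3))))" using t(2) by (rule of_nat_mono)
    also have "\<dots> = 1100 * (real (Suc (Suc J)) * ?B)" by (simp only: of_nat_mult of_nat_power of_nat_numeral ac_simps)
    also have "\<dots> \<le> 1100 * (((3 * \<epsilon>\<^sub>0 / ln 2 + (1 + \<epsilon>\<^sub>0) * (ln (2 * max a 1) / ln 2 + c)) * (1 / \<epsilon>) * ln (real n)) * ?B)"
      by (intro mult_left_mono mult_right_mono iteration_bound[OF eps_pos eps two_points Jbound]) auto
    also have "\<dots> = C * (?B * (1 / \<epsilon>) * ln (real n))" by (simp only: C_def ac_simps)
    finally show ?thesis .
  qed
  ultimately show ?thesis using t(1) out[symmetric] by blast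
qed

end

theorem theorem2:
  fixes a \<epsilon>\<^sub>0 :: real and c :: nat
  assumes "\<epsilon>\<^sub>0 > 0"
  shows "\<exists>C::real. \<forall>\<epsilon>. 0 < \<epsilon> \<and> \<epsilon> \<le> \<epsilon>\<^sub>0 \<longrightarrow>
    (\<exists>P::com. \<forall>(X::'a set) d m G ks pts n k.
       fair_instance X d m G ks \<and> n = card X \<and> k = (\<Sum>i<m. ks i) \<and> 2 \<le> n \<and>
       bij_betw pts {..<n} X \<and> aspect_ratio X d \<le> a * real n ^ c \<longrightarrow>
       (\<exists>t s S. exec (oracle_of d pts) P (input_state n m G ks pts \<epsilon>) t s \<and>
          S = output_set n pts s \<and> S \<subseteq> X \<and>
          diversity d S \<ge> opt_diversity X d m G ks / ereal ((real m + 1) * (1 + \<epsilon>)) \<and>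
          (\<forall>i<m. card (S \<inter> G i) \<ge> ks i) \<and>
          real t \<le> C * (real n * real (max 1 k) * real m ^ 3 * (1 / \<epsilon>) * ln (real n))))"
\<comment> \<open>The same program serves every \<epsilon>, which it reads from memory, so the
  constant can be fixed before \<epsilon>.\<close>
proof (intro exI[of _ "1100 * (3 * \<epsilon>\<^sub>0 / ln 2 + (1 + \<epsilon>\<^sub>0) * (ln (2 * max a 1) / ln 2 + c))"]
    exI[of _ fair_program] allI impI, elim conjE)
  fix \<epsilon> :: real and X :: "'a set" and d m G ks pts n k
  assume eps: "0 < \<epsilon>" "\<epsilon> \<le> \<epsilon>\<^sub>0" and "fair_instance X d m G ks" and "n = card X" "k = (\<Sum>i<m. ks i)"
    "2 \<le> n" "bij_betw pts {..<n} X" and aspect: "aspect_ratio X d \<le> a * real n ^ c"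
  then have "enumerated_instance X d m G ks n k pts \<epsilon>"
    by (simp add: enumerated_instance_def enumerated_instance_axioms_def)
  then show "\<exists>t s S. exec (oracle_of d pts) fair_program (input_state n m G ks pts \<epsilon>) t s \<and>
          S = output_set n pts s \<and> S \<subseteq> X \<and>
          diversity d S \<ge> opt_diversity X d m G ks / ereal ((real m + 1) * (1 + \<epsilon>)) \<and>
          (\<forall>i<m. card (S \<inter> G i) \<ge> ks i) \<and>
          real t \<le> 1100 * (3 * \<epsilon>\<^sub>0 / ln 2 + (1 + \<epsilon>\<^sub>0) * (ln (2 * max a 1) / ln 2 + c)) *
            (real n * real (max 1 k) * real m ^ 3 * (1 / \<epsilon>) * ln (real n))"
    using eps(2) aspect by (rule enumerated_instance.correct)
qed

end
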